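(* For every $n\in\mathbb N$, the $4$-input $2$-output bipartite strategy $$\mathcal S_n=\Big(|\phi_n\rangle;\ (\mathfrak P^{(n)}_i,I-\mathfrak P^{(n)}_i)_{i=1}^4;\ (\mathfrak P^{(n)}_i,I-\mathfrak P^{(n)}_i)_{i=1}^4\Big)$$ is self-tested by its correlation.
   Context: A bipartite strategy $\mathcal S=(|\psi\rangle;\mathcal M_1,\dots,\mathcal M_{N_A};\mathcal N_1,\dots,\mathcal N_{N_B})$ consists of finite-dimensional Hilbert spaces $\mathcal H_A,\mathcal H_B$, a unit vector $|\psi\rangle\in\mathcal H_A\otimes\mathcal H_B$, POVMs $\mathcal M_i=(\mathcal M_{i,a})_a$ on $\mathcal H_A$ and POVMs $\mathcal N_j=(\mathcal N_{j,b})_b$ on $\mathcal H_B$ (tuples of positive semidefinite operators summing to $I$). It is $(N_A,N_B)$-input and has the given numbers of outcomes; "$N$-input $K$-output" means $N_A=N_B=N$ and all measurements have $K$ outcomes. Its correlation is $p(a,b|i,j)=\langle\psi|\mathcal M_{i,a}\otimes\mathcal N_{j,b}|\psi\rangle$. A strategy $\widetilde{\mathcal S}=(|\widetilde\psi\rangle;\widetilde{\mathcal M};\widetilde{\mathcal N})$ on $\widetilde{\mathcal H}_A\otimes\widetilde{\mathcal H}_B$ (with the same numbers of inputs and outputs) is a local dilation of $\mathcal S$ if there exist finite-dimensional Hilbert spaces $\mathcal K_A,\mathcal K_B$, a state $|\mathrm{aux}\rangle\in\mathcal K_A\otimes\mathcal K_B$ and isometries $U_A:\mathcal H_A\to\widetilde{\mathcal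 H}_A\otimes\mathcal K_A$, $U_B:\mathcal H_B\to\widetilde{\mathcal H}_B\otimes\mathcal K_B$ with $(U_A\otimes U_B)(\mathcal M_{i,a}\otimes\mathcal N_{j,b})|\psi\rangle=(\widetilde{\mathcal M}_{i,a}\otimes\widetilde{\mathcal N}_{j,b})|\widetilde\psi\rangle\otimes|\mathrm{aux}\rangle$ for all $i,j,a,b$ (identifying $(\widetilde{\mathcal H}_A\otimes\mathcal K_A)\otimes(\widetilde{\mathcal H}_B\otimes\mathcal K_B)$ with $(\widetilde{\mathcal H}_A\otimes\widetilde{\mathcal H}_B)\otimes(\mathcal K_A\otimes\mathcal K_B)$). $\widetilde{\mathcal S}$ is self-tested by its correlation if it is a local dilation of every strategy with the same numbers of inputs and outputs and the same correlation. $|\phi_n\rangle=\frac1{\sqrt n}\sum_{i=1}^n|i\rangle|i\rangle\in\mathbb C^n\otimes\mathbb C^n$. For $n\in\mathbb N$, $\mathfrak P^{(n)}_1,\dots,\mathfrak P^{(n)}_4\in M_n(\mathbb R)$ denote orthogonal projections (real symmetric idempotent matrices) such that (i) $\mathfrak P^{(n)}_1+\dots+\mathfrak P^{(n)}_4=(2-\frac1n)I_n$; (ii) $\operatorname{rk}\mathfrak P^{(n)}_1=\lfloor\frac n2\rfloor-(-1)^n$ and $\operatorname{rk}\mathfrak P^{(n)}_i=\lfloor\frac n2\rfloor$ for $i=2,3,4$; (iii) the only subspaces of $\mathbb C^n$ invariant under all four matrices are $0$ and $\mathbb C^n$. Such quadruples exist for every $n$, and any two of them are simultaneously unitarily equivalent.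 *)

theory Defs
  imports Complex_Main "Jordan_Normal_Form.Matrix" "Jordan_Normal_Form.DL_Rank"
begin

definition adj :: "complex mat \<Rightarrow> complex mat" where
  "adj A = mat (dim_col A) (dim_row A) (\<lambda>(i,j). cnj (A $$ (j,i)))"

definition cinner :: "complex vec \<Rightarrow> complex vec \<Rightarrow> complex" where
  "cinner v w = (\<Sum>i<dim_vec v. cnj (v $ i) * w $ i)"

definition unit_vec_c :: "nat \<Rightarrow> complex vec \<Rightarrow> bool" where
  "unit_vec_c d v \<longleftrightarrow> v \<in> carrier_vec d \<and> cinner v v = 1"

definition psd :: "nat \<Rightarrow> complex mat \<Rightarrow> bool" where
  "psd d A \<longleftrightarrow> A \<in> carrier_mat d d \<and>
     (\<forall>v \<in> carrier_vec d. Im (cinner v (A *\<^sub>v v)) = 0 \<and> Re (cinner v (A *\<^sub>v v)) \<ge> 0)"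

definition isometry :: "nat \<Rightarrow> nat \<Rightarrow> complex mat \<Rightarrow> bool" where
  "isometry n m U \<longleftrightarrow> U \<in> carrier_mat n m \<and> adj U * U = 1\<^sub>m m"

text \<open>Kronecker (tensor) products; the index (i,j) of C^p \<otimes> C^q is i*q+j.\<close>
definition kron :: "complex mat \<Rightarrow> complex mat \<Rightarrow> complex mat" where
  "kron A B = mat (dim_row A * dim_row B) (dim_col A * dim_col B)
     (\<lambda>(i,j). A $$ (i div dim_row B, j div dim_col B) * B $$ (i mod dim_row B, j mod dim_col B))"

definition kron_vec :: "complex vec \<Rightarrow> complex vec \<Rightarrow> complex vec" where
  "kron_vec v w = vec (dim_vec v * dim_vec w)
     (\<lambda>i. v $ (i div dim_vec w) * w $ (i mod dim_vec w))"

text \<open>The canonical identification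
  (C^dA \<otimes> C^kA) \<otimes> (C^dB \<otimes> C^kB) \<cong> (C^dA \<otimes> C^dB) \<otimes> (C^kA \<otimes> C^kB).\<close>
definition regroup :: "nat \<Rightarrow> nat \<Rightarrow> nat \<Rightarrow> nat \<Rightarrow> complex vec \<Rightarrow> complex vec" where
  "regroup dA kA dB kB v = vec (dA * dB * (kA * kB))
     (\<lambda>idx. let ab = idx div (kA * kB); kk = idx mod (kA * kB);
                a = ab div dB; b = ab mod dB; k1 = kk div kB; k2 = kk mod kB
            in v $ ((a * kA + k1) * (dB * kB) + (b * kB + k2)))"

text \<open>A strategy: local dimensions, shared state, and measurement operators
  measA i a (input i, outcome a) for Alice and measB j b for Bob.\<close>
record strategy =
  dimA :: nat
  dimB :: nat
  state :: "complex vec"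
  measA :: "nat \<Rightarrow> nat \<Rightarrow> complex mat"
  measB :: "nat \<Rightarrow> nat \<Rightarrow> complex mat"

definition povm :: "nat \<Rightarrow> nat \<Rightarrow> (nat \<Rightarrow> complex mat) \<Rightarrow> bool" where
  "povm d K M \<longleftrightarrow> (\<forall>a<K. psd d (M a)) \<and> foldr (\<lambda>a acc. M a + acc) [0..<K] (0\<^sub>m d d) = 1\<^sub>m d"

definition is_strategy ::
  "nat \<Rightarrow> nat \<Rightarrow> (nat \<Rightarrow> nat) \<Rightarrow> (nat \<Rightarrow> nat) \<Rightarrow> strategy \<Rightarrow> bool" where
  "is_strategy NA NB outA outB S \<longleftrightarrow>
     dimA S > 0 \<and> dimB S > 0 \<and>
     unit_vec_c (dimA S * dimB S) (state S) \<and>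
     (\<forall>i<NA. povm (dimA S) (outA i) (measA S i)) \<and>
     (\<forall>j<NB. povm (dimB S) (outB j) (measB S j))"

definition correlation :: "strategy \<Rightarrow> nat \<Rightarrow> nat \<Rightarrow> nat \<Rightarrow> nat \<Rightarrow> complex" where
  "correlation S a b i j =
     cinner (state S) (kron (measA S i a) (measB S j b) *\<^sub>v state S)"

definition local_dilation ::
  "nat \<Rightarrow> nat \<Rightarrow> (nat \<Rightarrow> nat) \<Rightarrow> (nat \<Rightarrow> nat) \<Rightarrow> strategy \<Rightarrow> strategy \<Rightarrow> bool" where
  "local_dilation NA NB outA outB St S \<longleftrightarrow>
     (\<exists>kA kB aux UA UB.
        kA > 0 \<and> kB > 0 \<and> unit_vec_c (kA * kB) aux \<and>
        isometry (dimA St * kA) (dimA S) UA \<and>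
        isometry (dimB St * kB) (dimB S) UB \<and>
        (\<forall>i<NA. \<forall>j<NB. \<forall>a<outA i. \<forall>b<outB j.
           regroup (dimA St) kA (dimB St) kB
             (kron UA UB *\<^sub>v (kron (measA S i a) (measB S j b) *\<^sub>v state S))
           = kron_vec (kron (measA St i a) (measB St j b) *\<^sub>v state St) aux))"

definition self_tested ::
  "nat \<Rightarrow> nat \<Rightarrow> (nat \<Rightarrow> nat) \<Rightarrow> (nat \<Rightarrow> nat) \<Rightarrow> strategy \<Rightarrow> bool" where
  "self_tested NA NB outA outB St \<longleftrightarrow>
     (\<forall>S. is_strategy NA NB outA outB S \<and>
          (\<forall>i<NA. \<forall>j<NB. \<forall>a<outA i. \<forall>b<outB j.
              correlation S a b i j = correlation St a b i j)
        \<longrightarrow> local_dilation NA NB outA outB St S)"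

definition phi :: "nat \<Rightarrow> complex vec" where
  "phi n = vec (n * n) (\<lambda>k. if k div n = k mod n then 1 / complex_of_real (sqrt (real n)) else 0)"

definition cmat :: "real mat \<Rightarrow> complex mat" where
  "cmat P = map_mat complex_of_real P"

definition proj_meas :: "nat \<Rightarrow> real mat \<Rightarrow> nat \<Rightarrow> complex mat" where
  "proj_meas n P a = (if a = 0 then cmat P else 1\<^sub>m n - cmat P)"

definition S_strat :: "nat \<Rightarrow> (nat \<Rightarrow> real mat) \<Rightarrow> strategy" where
  "S_strat n P = \<lparr> dimA = n, dimB = n, state = phi n,
       measA = (\<lambda>i. proj_meas n (P i)), measB = (\<lambda>j. proj_meas n (P j)) \<rparr>"

text \<open>Conditions (i)-(iii) on the projections P 0, ..., P 3 (paper's P_1..P_4).\<close>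
definition complex_subspace :: "nat \<Rightarrow> complex vec set \<Rightarrow> bool" where
  "complex_subspace n W \<longleftrightarrow> W \<subseteq> carrier_vec n \<and> 0\<^sub>v n \<in> W \<and>
     (\<forall>v\<in>W. \<forall>w\<in>W. v + w \<in> W) \<and> (\<forall>c. \<forall>v\<in>W. c \<cdot>\<^sub>v v \<in> W)"

definition frak_P :: "nat \<Rightarrow> (nat \<Rightarrow> real mat) \<Rightarrow> bool" where
  "frak_P n P \<longleftrightarrow>
     (\<forall>i<4. P i \<in> carrier_mat n n \<and> transpose_mat (P i) = P i \<and> P i * P i = P i) \<and>
     P 0 + P 1 + P 2 + P 3 = (2 - 1 / real n) \<cdot>\<^sub>m 1\<^sub>m n \<and>
     int (vec_space.rank n (P 0)) = int (n div 2) - (-1) ^ n \<and>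
     (\<forall>i\<in>{1,2,3}. vec_space.rank n (P i) = n div 2) \<and>
     (\<forall>W. complex_subspace n W \<and> (\<forall>i<4. \<forall>v\<in>W. cmat (P i) *\<^sub>v v \<in> W)
          \<longrightarrow> W = {0\<^sub>v n} \<or> W = carrier_vec n)"

end

theory Submission
  imports Defs
begin

text \<open>
  Write the state of a strategy as a matrix \<open>\<Psi>\<close>, let \<open>A\<^sub>i\<close> be Alice's operators for outcome 0
  and \<open>C\<^sub>i\<close> the transposes of Bob's, so that the correlation is the trace of
  \<open>\<Psi>\<^sup>* A\<^sub>i \<Psi> C\<^sub>j\<close>. The perfect correlation on equal inputs forces \<open>A\<^sub>i \<Psi> = \<Psi> C\<^sub>i\<close>, and the
  \<open>A\<^sub>i\<close> restrict to projections on the range of \<open>\<Psi>\<close> whose sum is \<open>2 - 1/n\<close>; moreover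
  \<open>Q \<mapsto> tr (\<Psi>\<^sup>* Q \<Psi>)\<close> is tracial on the algebra they generate.

  On that range put \<open>X = A\<^sub>0 + A\<^sub>1 - 1\<close>, \<open>Y = A\<^sub>0 - A\<^sub>1\<close>, \<open>Y' = A\<^sub>2 - A\<^sub>3\<close>. Then \<open>Y\<close> maps
  \<open>x\<close>-eigenvectors of \<open>X\<close> to \<open>-x\<close>-eigenvectors and \<open>Y'\<close> maps them to \<open>(-x - 2/n)\<close>-eigenvectors.
  Starting from \<open>ker X\<close> and applying \<open>Y'\<close> and \<open>Y\<close> alternately one runs through \<open>n\<close> distinct
  eigenvalues, along multiples of isometries, before reaching 0; so \<open>ker X\<close> has weight at most
  \<open>1/n\<close>. On the other hand \<open>Y\<close> is a self-adjoint unitary on \<open>ker X\<close>, has no trace elsewhere, and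
  has weight \<open>\<plusminus>1/n\<close> by the rank condition. Hence equality holds, \<open>Y\<close> is a scalar on \<open>ker X\<close>, and the
  chain fills the whole range: the \<open>A\<^sub>i\<close> are the model projections tensored with the identity of
  \<open>ker X\<close>.
\<close>

subsection \<open>Rank and trace of idempotents\<close>

text \<open>A rank factorization \<open>P = K * D\<close> through a maximal independent set of
  columns turns idempotency into \<open>D * K = 1\<close>. The traces of \<open>K * D\<close> and
  \<open>D * K\<close> agree, and the latter counts the chosen columns.\<close>

lemma (in vec_space) trace_idempotent:
  assumes P: "P \<in> carrier_mat n n" and idem: "P * P = P"
  shows "(\<Sum>i<n. P $$ (i, i)) = of_nat (rank P)"
proof -
  have colsV: "set (cols P) \<subseteq> carrier_vec n" using cols_dim P by blast
  obtain S where S: "maximal S (\<lambda>T. T \<subseteq> set (cols P) \<and> lin_indpt T)" "finite S"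
    using maximal_exists_superset[of "set (cols P)" "(\<lambda>T. T \<subseteq> set (cols P) \<and> lin_indpt T)" "{}"]
    by (meson List.finite_set empty_subsetI finite_lin_indpt2 finite.emptyI empty_iff)
  then have SP: "S \<subseteq> set (cols P)" "lin_indpt S" by (auto simp: maximal_def)
  then have SV: "S \<subseteq> carrier_vec n" using colsV by blast
  obtain cs where cs: "set cs = S" "distinct cs" using finite_distinct_list[OF S(2)] by blast
  define r where "r = length cs"
  have rank: "rank P = r"
    using rank_card_indpt[OF P S(1)] distinct_card[OF cs(2)] cs(1) by (simp add: r_def)
  define K where "K = mat_of_cols n cs"
  have K: "K \<in> carrier_mat n r" by (simp add: K_def r_def)
  have colsK: "cols K = cs" using SV cs by (simp add: K_def)
  \<comment> \<open>By maximality of \<open>S\<close> every column of \<open>P\<close> is a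
    combination of the chosen ones; the coefficient vectors become the columns of
    \<open>D\<close>.\<close>
  have "\<exists>v \<in> carrier_vec r. K *\<^sub>v v = u" if "u \<in> set (cols P)" for u
  proof -
    have "u \<in> span S"
    proof (rule ccontr)
      assume u: "u \<notin> span S"
      then have "u \<notin> S" using in_own_span[OF SV] by blast
      have "lin_indpt (insert u S)"
        using lin_dep_iff_in_span[OF SV SP(2) _ \<open>u \<notin> S\<close>] u that colsV by auto
      then show False using S(1) that SP(1) \<open>u \<notin> S\<close> unfolding maximal_def by (metis insert_subset subset_insertI insertI1)
    qed
    then obtain a where "lincomb a S = u"
      using finite_in_span[OF S(2) SV] by blast
    then have "K *\<^sub>v vec r (\<lambda>i. a (col K i)) = u"
      using mat_mult_eq_lincomb[OF K, of a] cs colsK by simp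
    then show ?thesis by (intro bexI[of _ "vec r (\<lambda>i. a (col K i))"]) auto
  qed
  then have "\<forall>j<n. \<exists>v \<in> carrier_vec r. K *\<^sub>v v = col P j"
    using P by (simp add: cols_def)
  then obtain d where d: "\<And>j. j < n \<Longrightarrow> d j \<in> carrier_vec r" "\<And>j. j < n \<Longrightarrow> K *\<^sub>v d j = col P j"
    by metis
  define D where "D = mat_of_cols r (map d [0..<n])"
  have D: "D \<in> carrier_mat r n" using mat_of_cols_carrier(1)[of r "map d [0..<n]"] by (simp add: D_def)
  have colD: "col D j = d j" if "j < n" for j
    unfolding D_def using that d(1) by (subst col_mat_of_cols) auto
  have PKD: "P = K * D"
  proof (rule mat_col_eqI)
    fix j assume "j < dim_col (K * D)"
    then have "j < n" using D by simp
    then show "col P j = col (K * D) j"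
      using col_mult2[OF K D] colD d(2) by simp
  qed (use P K D in auto)
  have PK: "P * K = K"
  proof (rule mat_col_eqI)
    fix j assume "j < dim_col K"
    then have j: "j < r" using K by simp
    have "col K j \<in> set (cols P)" using SP(1) cs(1) colsK j K by (metis carrier_matD(2) cols_length cols_nth nth_mem subsetD)
    then obtain i where i: "i < n" "col K j = col P i" using P by (auto simp: cols_def)
    have "col (P * K) j = P *\<^sub>v col P i" using col_mult2[OF P K j] i by simp
    also have "\<dots> = col P i" using col_mult2[OF P P i(1)] idem by simp
    finally show "col (P * K) j = col K j" using i by simp
  qed (use P K in auto)
  have DK: "D * K = 1\<^sub>m r"
  proof (rule mat_col_eqI)
    fix j assume "j < dim_col (1\<^sub>m r :: 'a mat)"
    then have j: "j < r" by simp
    \<comment> \<open>\<open>K\<close> annihilates \<open>v\<close> because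
      \<open>K * D * K = P * K = K\<close>; independence of the columns of \<open>K\<close> then
      gives \<open>v = 0\<close>.\<close>
    define v where "v = col (D * K) j - unit_vec r j"
    have c: "col (D * K) j \<in> carrier_vec r" using D K by (intro carrier_vecI) simp
    have v: "v \<in> carrier_vec r" using c by (simp add: v_def)
    have "K *\<^sub>v col (D * K) j = col (K * (D * K)) j"
      using col_mult2[OF K _ j] D K by simp
    also have "K * (D * K) = K" using PK PKD assoc_mult_mat[OF K D K] by simp
    also have "col K j = K *\<^sub>v unit_vec r j" 
      using K j by (intro eq_vecI) (auto simp: scalar_prod_right_unit)
    finally have "K *\<^sub>v v = 0\<^sub>v n"
      using K c by (simp add: v_def mult_minus_distrib_mat_vec[OF K])
    then have v0: "v = 0\<^sub>v r"
      using lin_depI[OF K v] SP(2) cs colsK by auto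
    have "col (D * K) j = unit_vec r j"
    proof (rule eq_vecI)
      fix i assume "i < dim_vec (unit_vec r j :: 'a vec)"
      then have "v $ i = 0" using v0 by simp
      then show "col (D * K) j $ i = unit_vec r j $ i"
        using \<open>i < _\<close> c by (simp add: v_def)
    qed (use c D in auto)
    then show "col (D * K) j = col (1\<^sub>m r) j" using j by simp
  qed (use D K in auto)
  have "(\<Sum>i<n. P $$ (i, i)) = (\<Sum>i<n. \<Sum>k<r. K $$ (i, k) * D $$ (k, i))"
    unfolding PKD using K D by (auto simp: scalar_prod_def atLeast0LessThan intro!: sum.cong)
  also have "\<dots> = (\<Sum>k<r. \<Sum>i<n. D $$ (k, i) * K $$ (i, k))"
    by (subst sum.swap) (simp add: mult.commute)
  also have "\<dots> = (\<Sum>k<r. (D * K) $$ (k, k))"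
    using K D by (auto simp: scalar_prod_def atLeast0LessThan intro!: sum.cong)
  finally show ?thesis by (simp add: DK rank)
qed

subsection \<open>Finitely supported matrices\<close>

text \<open>Matrices of all sizes live in one type, so rectangular products need no dimension side
  conditions. \<open>idm d\<close> stands in for the identity of size \<open>d\<close>.\<close>

typedef fmat = "{f :: nat \<Rightarrow> nat \<Rightarrow> complex. \<exists>d. \<forall>i j. f i j \<noteq> 0 \<longrightarrow> i < d \<and> j < d}"
  morphisms ent Abs_fmat
  by (rule exI[of _ "\<lambda>_ _. 0"]) auto

lemma ent_bounded: "\<exists>d. \<forall>i j. ent M i j \<noteq> 0 \<longrightarrow> i < d \<and> j < d"
  using ent[of M] by simp

lemma fmat_eqI: "(\<And>i j. ent M i j = ent N i j) \<Longrightarrow> M = N"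
  by (metis ent_inject ext)

definition fm :: "nat \<Rightarrow> nat \<Rightarrow> (nat \<Rightarrow> nat \<Rightarrow> complex) \<Rightarrow> fmat" where
  "fm r c f = Abs_fmat (\<lambda>i j. if i < r \<and> j < c then f i j else 0)"

lemma ent_fm [simp]: "ent (fm r c f) i j = (if i < r \<and> j < c then f i j else 0)"
proof -
  have "\<exists>d. \<forall>i j. (if i < r \<and> j < c then f i j else 0) \<noteq> 0 \<longrightarrow> i < d \<and> j < d"
    by (rule exI[of _ "max r c"]) auto
  then show ?thesis
    unfolding fm_def by (subst Abs_fmat_inverse) auto
qed

lemma ex_common_bound:
  "\<exists>d. (\<forall>i j. ent M i j \<noteq> 0 \<longrightarrow> i < d \<and> j < d) \<and> (\<forall>i j. ent N i j \<noteq> 0 \<longrightarrow> i < d \<and> j < d)"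
proof -
  obtain d1 d2 where "\<forall>i j. ent M i j \<noteq> 0 \<longrightarrow> i < d1 \<and> j < d1"
    "\<forall>i j. ent N i j \<noteq> 0 \<longrightarrow> i < d2 \<and> j < d2"
    using ent_bounded by metis
  then show ?thesis
    by (intro exI[of _ "max d1 d2"]) (fastforce simp: less_max_iff_disj)
qed

instantiation fmat :: real_algebra
begin

definition "0 = fm 0 0 (\<lambda>_ _. 0)"
definition "M + N = Abs_fmat (\<lambda>i j. ent M i j + ent N i j)"
definition "- M = Abs_fmat (\<lambda>i j. - ent M i j)"
definition "M - N = Abs_fmat (\<lambda>i j. ent M i j - ent N i j)"
definition "scaleR r M = Abs_fmat (\<lambda>i j. of_real r * ent M i j)"
definition "M * N = Abs_fmat (\<lambda>i j. \<Sum>k | ent M i k \<noteq> 0. ent M i k * ent N k j)"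

lemma ent_zero: "ent 0 i j = 0"
  by (simp add: zero_fmat_def)

lemma ent_plus: "ent (M + N) i j = ent M i j + ent N i j"
proof -
  obtain d where "\<forall>i j. ent M i j \<noteq> 0 \<longrightarrow> i < d \<and> j < d" "\<forall>i j. ent N i j \<noteq> 0 \<longrightarrow> i < d \<and> j < d"
    using ex_common_bound by blast
  then have "\<forall>i j. ent M i j + ent N i j \<noteq> 0 \<longrightarrow> i < d \<and> j < d"
    by (metis add_0)
  then show ?thesis unfolding plus_fmat_def
    by (subst Abs_fmat_inverse) (auto intro!: exI[of _ d])
qed

lemma ent_minus: "ent (M - N) i j = ent M i j - ent N i j"
proof -
  obtain d where "\<forall>i j. ent M i j \<noteq> 0 \<longrightarrow> i < d \<and> j < d" "\<forall>i j. ent N i j \<noteq> 0 \<longrightarrow> i < d \<and> j < d"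
    using ex_common_bound by blast
  then have "\<forall>i j. ent M i j - ent N i j \<noteq> 0 \<longrightarrow> i < d \<and> j < d"
    by (metis diff_self)
  then show ?thesis unfolding minus_fmat_def
    by (subst Abs_fmat_inverse) (auto intro!: exI[of _ d])
qed

lemma ent_uminus: "ent (- M) i j = - ent M i j"
proof -
  obtain d where "\<forall>i j. ent M i j \<noteq> 0 \<longrightarrow> i < d \<and> j < d" using ent_bounded by blast
  then show ?thesis unfolding uminus_fmat_def
    by (subst Abs_fmat_inverse) (auto intro!: exI[of _ d])
qed

lemma ent_scaleR: "ent (r *\<^sub>R M) i j = of_real r * ent M i j"
proof -
  obtain d where "\<forall>i j. ent M i j \<noteq> 0 \<longrightarrow> i < d \<and> j < d" using ent_bounded by blast
  then show ?thesis unfolding scaleR_fmat_def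
    by (subst Abs_fmat_inverse) (auto intro!: exI[of _ d])
qed

lemma ent_times_supp: "ent (M * N) i j = (\<Sum>k | ent M i k \<noteq> 0. ent M i k * ent N k j)"
proof -
  obtain d where d: "\<forall>i j. ent M i j \<noteq> 0 \<longrightarrow> i < d \<and> j < d" "\<forall>i j. ent N i j \<noteq> 0 \<longrightarrow> i < d \<and> j < d"
    using ex_common_bound by blast
  have "\<exists>d. \<forall>i j. (\<Sum>k | ent M i k \<noteq> 0. ent M i k * ent N k j) \<noteq> 0 \<longrightarrow> i < d \<and> j < d"
  proof (intro exI[of _ d] allI impI)
    fix i j assume "(\<Sum>k | ent M i k \<noteq> 0. ent M i k * ent N k j) \<noteq> 0"
    then obtain k where "ent M i k * ent N k j \<noteq> 0"
      by (meson sum.not_neutral_contains_not_neutral)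
    then show "i < d \<and> j < d" using d by auto
  qed
  then show ?thesis unfolding times_fmat_def
    by (subst Abs_fmat_inverse) auto
qed

text \<open>The product sums over the support of a row of the left factor; any bound on the columns
  of that factor, or in \<open>ent_times'\<close> on the rows of the right one, may replace this
  support.\<close>

lemma ent_times:
  assumes "\<And>i k. d \<le> k \<Longrightarrow> ent M i k = 0"
  shows "ent (M * N) i j = (\<Sum>k<d. ent M i k * ent N k j)"
  unfolding ent_times_supp
  by (rule sum.mono_neutral_left) (use assms in \<open>auto simp: not_le[symmetric]\<close>)

lemma ent_times':
  assumes "\<And>k j. d \<le> k \<Longrightarrow> ent N k j = 0"
  shows "ent (M * N) i j = (\<Sum>k<d. ent M i k * ent N k j)"
proof -
  obtain e where e: "\<forall>i j. ent M i j \<noteq> 0 \<longrightarrow> i < e \<and> j < e" using ent_bounded by blast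
  have "ent (M * N) i j = (\<Sum>k<max d e. ent M i k * ent N k j)"
    by (rule ent_times) (metis e max.bounded_iff not_le)
  also have "\<dots> = (\<Sum>k<d. ent M i k * ent N k j)"
    by (rule sum.mono_neutral_right) (use assms in auto)
  finally show ?thesis .
qed

instance
proof
  fix M N K :: fmat and r s :: real
  show "M * N * K = M * (N * K)"
  proof -
    obtain d where d: "\<forall>i j. ent M i j \<noteq> 0 \<longrightarrow> i < d \<and> j < d" "\<forall>i j. ent N i j \<noteq> 0 \<longrightarrow> i < d \<and> j < d"
      using ex_common_bound by blast
    have dM: "\<And>i k. d \<le> k \<Longrightarrow> ent M i k = 0" and dN: "\<And>i k. d \<le> k \<Longrightarrow> ent N i k = 0"
      using d not_le by blast+
    have dMN: "ent (M * N) i k = 0" if "d \<le> k" for i k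
      using dN[OF that] by (simp add: ent_times[OF dM])
    show ?thesis
      by (rule fmat_eqI)
        (simp add: ent_times[OF dM] ent_times[OF dN] ent_times[OF dMN] sum_distrib_left
          sum_distrib_right mult.assoc, subst sum.swap, simp)
  qed
  have dM: "\<exists>d. \<forall>i k. d \<le> k \<longrightarrow> ent M i k = 0" for M using ent_bounded[of M] not_le by meson
  show "(M + N) * K = M * K + N * K"
  proof -
    obtain d where "\<forall>k j. d \<le> k \<longrightarrow> ent K k j = 0" using ent_bounded[of K] not_le by meson
    then have d: "\<And>k j. d \<le> k \<Longrightarrow> ent K k j = 0" by blast
    show ?thesis by (rule fmat_eqI) (simp add: ent_plus ent_times'[OF d] algebra_simps sum.distrib)
  qed
  show "M * (N + K) = M * N + M * K"
  proof -
    obtain d where "\<forall>i k. d \<le> k \<longrightarrow> ent M i k = 0" using dM by blast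
    then have d: "\<And>i k. d \<le> k \<Longrightarrow> ent M i k = 0" by blast
    show ?thesis by (rule fmat_eqI) (simp add: ent_plus ent_times[OF d] algebra_simps sum.distrib)
  qed
  show "r *\<^sub>R M * N = r *\<^sub>R (M * N)"
  proof -
    obtain d where "\<forall>k j. d \<le> k \<longrightarrow> ent N k j = 0" using ent_bounded[of N] not_le by meson
    then have d: "\<And>k j. d \<le> k \<Longrightarrow> ent N k j = 0" by blast
    show ?thesis by (rule fmat_eqI) (simp add: ent_scaleR ent_times'[OF d] algebra_simps sum_distrib_left)
  qed
  show "M * r *\<^sub>R N = r *\<^sub>R (M * N)"
  proof -
    obtain d where "\<forall>i k. d \<le> k \<longrightarrow> ent M i k = 0" using dM by blast
    then have d: "\<And>i k. d \<le> k \<Longrightarrow> ent M i k = 0" by blast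
    show ?thesis by (rule fmat_eqI) (simp add: ent_scaleR ent_times[OF d] algebra_simps sum_distrib_left)
  qed
qed (rule fmat_eqI, simp add: ent_zero ent_plus ent_minus ent_uminus ent_scaleR algebra_simps)+

end

lemmas ent_simps = ent_zero ent_plus ent_minus ent_uminus ent_scaleR

lemma ent_sum: "ent (\<Sum>x\<in>S. f x) i j = (\<Sum>x\<in>S. ent (f x) i j)"
  by (induction S rule: infinite_finite_induct) (auto simp: ent_simps)

section \<open>Adjoint and trace\<close>

definition dag :: "fmat \<Rightarrow> fmat" where
  "dag M = Abs_fmat (\<lambda>i j. cnj (ent M j i))"

lemma ent_dag [simp]: "ent (dag M) i j = cnj (ent M j i)"
proof -
  obtain d where "\<forall>i j. ent M i j \<noteq> 0 \<longrightarrow> i < d \<and> j < d" using ent_bounded by blast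
  then show ?thesis unfolding dag_def
    by (subst Abs_fmat_inverse) (auto intro!: exI[of _ d])
qed

lemma dag_dag [simp]: "dag (dag M) = M"
  by (rule fmat_eqI) simp

lemma dag_linear [simp]:
  "dag 0 = 0" "dag (M + N) = dag M + dag N" "dag (M - N) = dag M - dag N" "dag (- M) = - dag M"
  "dag (r *\<^sub>R M) = r *\<^sub>R dag M"
  by (rule fmat_eqI, simp add: ent_simps)+

lemma dag_sum: "dag (\<Sum>x\<in>S. f x) = (\<Sum>x\<in>S. dag (f x))"
  by (rule fmat_eqI) (simp add: ent_sum)

lemma dag_times [simp]: "dag (M * N) = dag N * dag M"
proof (rule fmat_eqI)
  fix i j
  obtain d where d: "\<forall>i j. ent M i j \<noteq> 0 \<longrightarrow> i < d \<and> j < d" using ent_bounded by blast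
  have "\<And>i k. d \<le> k \<Longrightarrow> ent M i k = 0" "\<And>k j. d \<le> k \<Longrightarrow> ent (dag M) k j = 0"
    using d not_le by auto
  then show "ent (dag (M * N)) i j = ent (dag N * dag M) i j"
    by (simp add: ent_times[of d] ent_times'[of d "dag M"] mult.commute)
qed

text \<open>All scalars in the argument are real, so the real part of the trace suffices; it makes
  the matrices a real *-algebra with a faithful positive trace.\<close>
definition trR :: "fmat \<Rightarrow> real" where
  "trR M = (\<Sum>i | ent M i i \<noteq> 0. Re (ent M i i))"

lemma trR_eq:
  assumes "\<And>i. d \<le> i \<Longrightarrow> ent M i i = 0"
  shows "trR M = (\<Sum>i<d. Re (ent M i i))"
  unfolding trR_def
  by (rule sum.mono_neutral_left) (use assms in \<open>auto simp: not_le[symmetric]\<close>)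

lemma trR_linear [simp]:
  "trR 0 = 0" "trR (M + N) = trR M + trR N" "trR (M - N) = trR M - trR N" "trR (- M) = - trR M"
  "trR (r *\<^sub>R M) = r * trR M"
proof -
  obtain d where "\<forall>i j. ent M i j \<noteq> 0 \<longrightarrow> i < d \<and> j < d" "\<forall>i j. ent N i j \<noteq> 0 \<longrightarrow> i < d \<and> j < d"
    using ex_common_bound by blast
  then have d: "\<And>i. d \<le> i \<Longrightarrow> ent M i i = 0" "\<And>i. d \<le> i \<Longrightarrow> ent N i i = 0"
    using not_le by blast+
  show "trR 0 = 0" by (simp add: trR_def ent_simps)
  show "trR (M + N) = trR M + trR N" "trR (M - N) = trR M - trR N" "trR (- M) = - trR M"
    "trR (r *\<^sub>R M) = r * trR M"
    by (simp_all add: trR_eq[of d, OF d(1)] trR_eq[of d, OF d(2)] trR_eq[of d] d ent_simps sum.distrib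
        sum_subtractf sum_negf sum_distrib_left)
qed

lemma trR_sum: "trR (\<Sum>x\<in>S. f x) = (\<Sum>x\<in>S. trR (f x))"
  by (induction S rule: infinite_finite_induct) auto

lemma trR_commute: "trR (M * N) = trR (N * M)"
proof -
  obtain d where d: "\<forall>i j. ent M i j \<noteq> 0 \<longrightarrow> i < d \<and> j < d" "\<forall>i j. ent N i j \<noteq> 0 \<longrightarrow> i < d \<and> j < d"
    using ex_common_bound by blast
  have z: "\<And>i k. d \<le> k \<Longrightarrow> ent M i k = 0" "\<And>i k. d \<le> k \<Longrightarrow> ent N i k = 0"
    using d not_le by blast+
  have "trR (M * N) = (\<Sum>i<d. Re (\<Sum>k<d. ent M i k * ent N k i))"
    by (subst trR_eq[of d]) (simp_all add: ent_times[OF z(1)] z)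
  also have "\<dots> = (\<Sum>k<d. Re (\<Sum>i<d. ent N k i * ent M i k))"
    by (subst Re_sum, subst Re_sum, subst sum.swap) (simp add: mult.commute)
  also have "\<dots> = trR (N * M)"
    by (subst trR_eq[of d]) (simp_all add: ent_times[OF z(2)] z)
  finally show ?thesis .
qed

lemma trR_dag_self:
  assumes "\<And>i j. d \<le> i \<Longrightarrow> ent M i j = 0" "\<And>i j. e \<le> j \<Longrightarrow> ent M i j = 0"
  shows "trR (dag M * M) = (\<Sum>j<e. \<Sum>i<d. (cmod (ent M i j))\<^sup>2)"
proof -
  have e: "ent (dag M * M) i j = (\<Sum>k<d. cnj (ent M k i) * ent M k j)" for i j
    by (simp add: ent_times'[of d M, OF assms(1)])
  show ?thesis
    by (subst trR_eq[of e])
      (simp_all add: e assms complex_norm_square[symmetric] mult.commute[of "cnj _"]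
        flip: of_real_power)
qed

lemma trR_dag_self_nonneg: "0 \<le> trR (dag M * M)"
  and trR_dag_self_eq_0: "trR (dag M * M) = 0 \<longleftrightarrow> M = 0"
proof -
  obtain d where d: "\<forall>i j. ent M i j \<noteq> 0 \<longrightarrow> i < d \<and> j < d" using ent_bounded by blast
  have z: "\<And>i j. d \<le> i \<Longrightarrow> ent M i j = 0" "\<And>i j. d \<le> j \<Longrightarrow> ent M i j = 0"
    using d not_le by blast+
  note eq = trR_dag_self[OF z]
  show "0 \<le> trR (dag M * M)" by (auto simp: eq intro!: sum_nonneg)
  have "M = 0" if "trR (dag M * M) = 0"
  proof (rule fmat_eqI)
    fix i j
    have "\<forall>j<d. \<forall>i<d. ent M i j = 0"
      using that by (auto simp: eq sum_nonneg_eq_0_iff sum_nonneg)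
    then show "ent M i j = ent 0 i j" using z by (metis ent_zero not_le)
  qed
  then show "trR (dag M * M) = 0 \<longleftrightarrow> M = 0" by auto
qed

section \<open>Truncated identities, matrix units and complex scalars\<close>

definition idm :: "nat \<Rightarrow> fmat" where
  "idm d = fm d d (\<lambda>i j. if i = j then 1 else 0)"

definition munit :: "nat \<Rightarrow> nat \<Rightarrow> fmat" where
  "munit i j = fm (Suc i) (Suc j) (\<lambda>k l. if k = i \<and> l = j then 1 else 0)"

text \<open>The algebra instance has only real scalars, while individual matrix entries are
  complex.\<close>

definition cscale :: "complex \<Rightarrow> fmat \<Rightarrow> fmat" where
  "cscale z M = Abs_fmat (\<lambda>i j. z * ent M i j)"

lemma ent_idm [simp]: "ent (idm d) i j = (if i = j \<and> i < d then 1 else 0)"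
  by (simp add: idm_def)

lemma ent_munit [simp]: "ent (munit i j) k l = (if k = i \<and> l = j then 1 else 0)"
  by (simp add: munit_def)

lemma ent_cscale [simp]: "ent (cscale z M) i j = z * ent M i j"
proof -
  obtain d where "\<forall>i j. ent M i j \<noteq> 0 \<longrightarrow> i < d \<and> j < d" using ent_bounded by blast
  then show ?thesis unfolding cscale_def
    by (subst Abs_fmat_inverse) (auto intro!: exI[of _ d])
qed

lemma ent_idm_times [simp]: "ent (idm d * M) i j = (if i < d then ent M i j else 0)"
  by (subst ent_times[of d]) (auto simp: if_distrib[of "\<lambda>x. x * _"] if_distribR cong: if_cong)

lemma dag_idm [simp]: "dag (idm d) = idm d"
  by (rule fmat_eqI) auto

lemma dag_munit [simp]: "dag (munit i j) = munit j i"
  by (rule fmat_eqI) auto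

lemma ent_times_idm [simp]: "ent (M * idm d) i j = (if j < d then ent M i j else 0)"
proof -
  have "M * idm d = dag (idm d * dag M)" by simp
  then show ?thesis by (simp only: ent_dag ent_idm_times) simp
qed

lemma ent_munit_times [simp]: "ent (munit i j * M) k l = (if k = i then ent M j l else 0)"
  by (subst ent_times[of "Suc j"]) (auto simp: if_distrib[of "\<lambda>x. x * _"] if_distribR cong: if_cong)

lemma ent_times_munit [simp]: "ent (M * munit i j) k l = (if l = j then ent M k i else 0)"
proof -
  have "M * munit i j = dag (munit j i * dag M)" by simp
  then show ?thesis by (simp only: ent_dag ent_munit_times) simp
qed

lemma idm_idm [simp]: "idm d * idm d = idm d"
  by (rule fmat_eqI) auto

lemma munit_munit [simp]: "munit i j * munit j k = munit i k"
  by (rule fmat_eqI) auto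

lemma munit_times_munit: "munit k i * M * munit j l = cscale (ent M i j) (munit k l)"
  by (rule fmat_eqI) auto

lemma idm_Suc: "idm (Suc m) = idm m + munit m m"
  by (rule fmat_eqI) (auto simp: ent_simps)

lemma sum_munit: "(\<Sum>i<d. munit i i) = idm d"
  by (induction d) (auto simp: idm_Suc intro: fmat_eqI simp: ent_simps)

lemma ex_times_idm: "\<exists>d. M * idm d = M"
proof -
  obtain d where "\<forall>i j. ent M i j \<noteq> 0 \<longrightarrow> i < d \<and> j < d" using ent_bounded by blast
  then show ?thesis by (intro exI[of _ d] fmat_eqI) auto
qed

lemma cscale_times [simp]: "cscale z M * N = cscale z (M * N)"
proof -
  obtain d where "\<forall>i j. ent M i j \<noteq> 0 \<longrightarrow> i < d \<and> j < d" using ent_bounded by blast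
  then have "\<And>i j. d \<le> j \<Longrightarrow> ent M i j = 0" using not_le by blast
  then show ?thesis by (intro fmat_eqI) (simp add: ent_times[of d] sum_distrib_left mult.assoc)
qed

lemma times_cscale [simp]: "M * cscale z N = cscale z (M * N)"
proof -
  obtain d where "\<forall>i j. ent M i j \<noteq> 0 \<longrightarrow> i < d \<and> j < d" using ent_bounded by blast
  then have "\<And>i j. d \<le> j \<Longrightarrow> ent M i j = 0" using not_le by blast
  then show ?thesis by (intro fmat_eqI) (simp add: ent_times[of d] sum_distrib_left algebra_simps)
qed

lemma cscale_of_real: "cscale (of_real r) M = r *\<^sub>R M"
  by (rule fmat_eqI) (simp add: ent_simps)

section \<open>Range projections\<close>

lemma dag_self_munit:
  assumes "M * munit m m = M"
  obtains t where "0 \<le> t" "dag M * M = t *\<^sub>R munit m m" "t = 0 \<longleftrightarrow> M = 0"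
proof -
  have "dag M * M = munit m m * (dag M * M) * munit m m"
    by (metis assms dag_munit dag_times mult.assoc)
  then have eq: "dag M * M = cscale (ent (dag M * M) m m) (munit m m)"
    by (simp add: munit_times_munit)
  obtain d where "\<forall>i j. ent M i j \<noteq> 0 \<longrightarrow> i < d \<and> j < d" using ent_bounded by blast
  then have "\<And>i j. d \<le> i \<Longrightarrow> ent M i j = 0" using not_le by blast
  then have "ent (dag M * M) m m = of_real (\<Sum>k<d. (cmod (ent M k m))\<^sup>2)"
    by (simp add: ent_times'[of d M] complex_norm_square mult.commute[of "cnj _"] del: of_real_power)
  then have *: "dag M * M = (\<Sum>k<d. (cmod (ent M k m))\<^sup>2) *\<^sub>R munit m m"
    using eq cscale_of_real by metis
  have "trR (munit m m) = 1" by (subst trR_eq[of "Suc m"]) auto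
  then have "(\<Sum>k<d. (cmod (ent M k m))\<^sup>2) = trR (dag M * M)"
    unfolding * by simp
  then show thesis using that[OF _ *] trR_dag_self_nonneg[of M] trR_dag_self_eq_0[of M] by simp
qed

text \<open>Gram-Schmidt on the columns of \<open>M\<close>.\<close>
lemma ex_range_proj: "\<exists>R. dag R = R \<and> R * M = M \<and> (\<exists>Z. R = M * Z)"
proof -
  have "\<exists>R Z. R = M * Z \<and> dag R = R \<and> R * R = R \<and> R * M * idm m = M * idm m" for m
  proof (induction m)
    case 0
    have "idm 0 = 0" by (rule fmat_eqI) (simp add: ent_simps)
    then show ?case by (intro exI[of _ 0]) simp
  next
    case (Suc m)
    then obtain R Z where R: "R = M * Z" "dag R = R" "R * R = R" "R * M * idm m = M * idm m" by blast
    \<comment> \<open>\<open>w\<close> is the part of column \<open>m\<close> orthogonal to the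
      range of \<open>R\<close>; if it is nonzero, the normalized \<open>w * dag w\<close> is the
      projection to be added to \<open>R\<close>.\<close>
    define w where "w = (M - R * M) * munit m m"
    have wm: "w * munit m m = w" by (simp add: w_def mult.assoc)
    have Rw: "R * w = 0" by (simp add: w_def right_diff_distrib left_diff_distrib mult.assoc[symmetric] R(3))
    then have wR: "dag w * R = 0" using R(2) by (metis dag_linear(1) dag_times)
    have Rwx: "R * (w * x) = 0" for x using Rw by (simp add: mult.assoc[symmetric])
    have wRx: "dag w * (R * x) = 0" for x using wR by (simp add: mult.assoc[symmetric])
    have Mw: "w = M * (munit m m - Z * M * munit m m)"
      by (simp add: w_def R(1) left_diff_distrib right_diff_distrib mult.assoc)
    have ME: "M * munit m m = w + R * M * munit m m" by (simp add: w_def left_diff_distrib)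
    obtain t where t: "dag w * w = t *\<^sub>R munit m m" "t = 0 \<longleftrightarrow> w = 0"
      using dag_self_munit[OF wm] by metis
    show ?case
    proof (cases "t = 0")
      case True
      then have "R * M * munit m m = M * munit m m" using t(2) ME by (metis add_0)
      then have "R * M * idm (Suc m) = M * idm (Suc m)"
        by (simp only: idm_Suc distrib_left R(4))
      then show ?thesis using R by blast
    next
      case False
      have ww: "dag w * (w * x) = t *\<^sub>R (munit m m * x)" for x
        using t(1) by (simp add: mult.assoc[symmetric])
      have Ew: "munit m m * dag w = dag w" using wm by (metis dag_munit dag_times)
      define Q where "Q = R + (1/t) *\<^sub>R (w * dag w)"
      have "Q = M * (Z + (1/t) *\<^sub>R ((munit m m - Z * M * munit m m) * dag w))"
        using Mw R(1) by (simp add: Q_def distrib_left mult.assoc)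
      moreover have "dag Q = Q" by (simp add: Q_def R(2))
      moreover have "Q * Q = Q"
        using False by (simp add: Q_def distrib_left distrib_right R(3) Rw wRx ww Ew mult.assoc wR Rwx)
      moreover have "Q * M * idm (Suc m) = M * idm (Suc m)"
      proof -
        have "dag w * (M * idm m) = 0"
          using R(4) wRx by (metis mult.assoc)
        moreover have "dag w * (M * munit m m) = t *\<^sub>R munit m m"
        proof -
          have "dag w * (M * munit m m) = dag w * (w + R * M * munit m m)" using ME by (rule arg_cong)
          then show ?thesis by (simp add: distrib_left t(1) mult.assoc wRx)
        qed
        ultimately have "Q * M * idm (Suc m) = R * M * idm m + R * M * munit m m + w * munit m m"
          using False by (simp add: Q_def idm_Suc distrib_left distrib_right mult.assoc)
        also have "\<dots> = M * idm m + (w + R * M * munit m m)"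
          by (simp only: R(4) wm) (simp add: add_ac)
        also have "\<dots> = M * idm (Suc m)" by (simp only: ME[symmetric] idm_Suc distrib_left)
        finally show ?thesis .
      qed
      ultimately show ?thesis by blast
    qed
  qed
  moreover obtain d where "M * idm d = M" using ex_times_idm by blast
  ultimately show ?thesis by (metis mult.assoc)
qed

text \<open>The three conditions determine the orthogonal projection onto the column space of
  \<open>M\<close>; \<open>R = M * Z\<close> keeps its range from being larger than that
  space.\<close>

definition rproj :: "fmat \<Rightarrow> fmat" where
  "rproj M = (SOME R. dag R = R \<and> R * M = M \<and> (\<exists>Z. R = M * Z))"

lemma dag_rproj [simp]: "dag (rproj M) = rproj M"
  and rproj_times [simp]: "rproj M * M = M"
  and rproj_range: "\<exists>Z. rproj M = M * Z"
  using someI_ex[OF ex_range_proj, folded rproj_def] by auto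

lemma rproj_idem [simp]: "rproj M * rproj M = rproj M"
  using rproj_range rproj_times by (metis mult.assoc)

section \<open>Positive semidefinite matrices and their factorization\<close>

definition psdf :: "fmat \<Rightarrow> bool" where
  "psdf D \<longleftrightarrow> dag D = D \<and> (\<forall>V. 0 \<le> trR (dag V * D * V))"

text \<open>A variation argument: with \<open>u = D * V\<close>, positivity at
  \<open>r *\<^sub>R V - u\<close> bounds \<open>2 * r\<close> times the squared norm of
  \<open>u\<close> for every \<open>r\<close>, so \<open>u\<close> vanishes.\<close>

lemma psdf_kills:
  assumes "psdf D" "dag V * D * V = 0"
  shows "D * V = 0"
proof -
  define u where "u = D * V"
  have D: "dag D = D" using assms(1) by (simp add: psdf_def)
  have ineq: "2 * r * trR (dag u * u) \<le> trR (dag u * D * u)" for r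
  proof -
    have Du: "dag V * (D * u) = dag u * u" by (simp add: u_def D mult.assoc)
    have z: "dag V * u = 0" using assms(2) by (simp add: u_def mult.assoc)
    have "0 \<le> trR (dag (r *\<^sub>R V - u) * D * (r *\<^sub>R V - u))"
      using assms(1) by (simp add: psdf_def del: dag_linear)
    also have "\<dots> = trR (dag u * D * u) - 2 * r * trR (dag u * u)"
      by (simp add: left_diff_distrib right_diff_distrib mult.assoc z Du u_def[symmetric])
    finally show ?thesis by simp
  qed
  have "trR (dag u * u) = 0"
  proof (rule ccontr)
    assume "trR (dag u * u) \<noteq> 0"
    then have "2 * ((trR (dag u * D * u) + 1) / (2 * trR (dag u * u))) * trR (dag u * u)
        = trR (dag u * D * u) + 1" by simp
    then show False using ineq[of "(trR (dag u * D * u) + 1) / (2 * trR (dag u * u))"] by linarith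
  qed
  then show ?thesis unfolding trR_dag_self_eq_0 by (simp add: u_def)
qed

text \<open>Cholesky decomposition: \<open>D - D E D / (E D E)\<close> stays positive and vanishes on one more
  column.\<close>
lemma psdf_factor:
  assumes "psdf D"
  obtains L where "D = L * dag L"
proof -
  obtain d where d: "D * idm d = D" using ex_times_idm by blast
  \<comment> \<open>Since \<open>D'\<close> lives on the first \<open>d\<close> columns and vanishes
    on the first \<open>m\<close>, nothing of it remains at \<open>m = d\<close>.\<close>
  have "\<exists>L D'. L * idm m = L \<and> D = L * dag L + D' \<and> psdf D' \<and> D' * idm m = 0 \<and> D' * idm d = D'" for m
  proof (induction m)
    case 0
    have "idm 0 = 0" by (rule fmat_eqI) (simp add: ent_simps)
    then show ?case using assms d by (intro exI[of _ 0] exI[of _ D]) simp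
  next
    case (Suc m)
    then obtain L D' where L: "L * idm m = L" "D = L * dag L + D'" "psdf D'" "D' * idm m = 0" "D' * idm d = D'" by blast
    have D': "dag D' = D'" and pos: "\<And>V. 0 \<le> trR (dag V * D' * V)"
      using L(3) by (auto simp: psdf_def)
    have ID: "idm m * D' = 0" using L(4) D' by (metis dag_idm dag_linear(1) dag_times)
    have im: "idm m * munit m m = 0" by (rule fmat_eqI) (auto simp: ent_simps)
    have mi: "munit m m * idm m = 0" by (rule fmat_eqI) (auto simp: ent_simps)
    have EDE: "munit m m * D' * munit m m = Re (ent D' m m) *\<^sub>R munit m m"
    proof -
      have "ent D' m m = cnj (ent D' m m)" by (subst D'[symmetric]) simp
      then have "ent D' m m = of_real (Re (ent D' m m))"
        by (metis cnj.simps(2) complex_is_Real_iff neg_equal_zero of_real_Re)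
      then show ?thesis by (simp only: munit_times_munit cscale_of_real flip: cscale_of_real[of "Re (ent D' m m)"])
    qed
    define t where "t = Re (ent D' m m)"
    define u where "u = D' * munit m m"
    have tr_munit: "trR (munit m m) = 1" by (subst trR_eq[of "Suc m"]) auto
    have t0: "0 \<le> t" using pos[of "munit m m"] EDE tr_munit by (simp add: t_def)
    have LE: "L * munit m m = 0" using L(1) im by (metis mult.assoc mult_zero_right)
    show ?case
    proof (cases "t = 0")
      case True
      \<comment> \<open>A zero diagonal entry of a positive matrix forces the whole column to
        vanish.\<close>
      then have "D' * munit m m = 0" using EDE psdf_kills[OF L(3), of "munit m m"] by (simp add: t_def)
      moreover have "L * idm (Suc m) = L" 
        by (simp add: idm_Suc distrib_left L(1) LE)
      ultimately show ?thesis using L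
        by (intro exI[of _ L] exI[of _ D']) (simp add: idm_Suc distrib_left)
    next
      case False
      have Eu: "munit m m * u = t *\<^sub>R munit m m" using EDE by (simp add: u_def t_def mult.assoc)
      have um: "u * munit m m = u" by (simp add: u_def mult.assoc)
      have du: "dag u = munit m m * D'" by (simp add: u_def D')
      have Edu: "munit m m * dag u = dag u" by (simp add: du mult.assoc[symmetric])
      have uI: "idm m * u = 0" using ID by (simp add: u_def mult.assoc[symmetric])
      have duI: "dag u * idm m = 0" using uI by (metis dag_idm dag_linear(1) dag_times)
      define D2 where "D2 = D' - (1/t) *\<^sub>R (u * dag u)"
      define L2 where "L2 = L + (1 / sqrt t) *\<^sub>R u"
      have uIm: "u * idm m = 0" using mi by (simp add: u_def mult.assoc)
      have Lu: "L * dag u = 0"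
        using L(1) uIm by (metis dag_idm dag_linear(1) dag_times mult.assoc mult_zero_right)
      have uL: "u * dag L = 0" using Lu by (metis dag_dag dag_linear(1) dag_times)
      have "L2 * idm (Suc m) = L2"
        by (simp add: L2_def idm_Suc distrib_left distrib_right L(1) LE um uIm)
      moreover have "D = L2 * dag L2 + D2"
      proof -
        have "1 / sqrt t * (1 / sqrt t) = 1 / t" using t0 by simp
        then show ?thesis
          by (simp add: L2_def D2_def distrib_left distrib_right Lu uL L(2))
      qed
      moreover have "psdf D2"
        unfolding psdf_def
      proof (intro conjI allI)
        show "dag D2 = D2" by (simp add: D2_def D')
        fix V
        \<comment> \<open>Correcting row \<open>m\<close> of \<open>V\<close> makes
          \<open>D' * W = D2 * V\<close>, and \<open>munit m m * D2 = 0\<close>; so the form of the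
          Schur complement \<open>D2\<close> at \<open>V\<close> is that of \<open>D'\<close> at
          \<open>W\<close>.\<close>
        define W where "W = V - (1/t) *\<^sub>R (munit m m * dag u * V)"
        have DW: "D' * W = D2 * V"
          by (simp add: W_def D2_def left_diff_distrib right_diff_distrib mult.assoc)
            (simp add: u_def mult.assoc)
        have ED2: "munit m m * D2 = 0"
          using False by (simp add: D2_def right_diff_distrib du[symmetric] Eu mult.assoc[symmetric])
            (simp add: Edu)
        have "dag W = dag V - (1/t) *\<^sub>R (dag V * u * munit m m)"
          by (simp add: W_def mult.assoc)
        then have "dag W * (D2 * V) = dag V * D2 * V"
          using ED2 by (simp add: left_diff_distrib mult.assoc) (simp add: mult.assoc[symmetric, of "munit m m"])
        then have "trR (dag V * D2 * V) = trR (dag W * D' * W)"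
          using DW by (simp add: mult.assoc)
        then show "0 \<le> trR (dag V * D2 * V)" using pos by simp
      qed
      moreover have "D2 * idm (Suc m) = 0"
      proof -
        have "u * dag u * munit m m = t *\<^sub>R u"
          using Eu by (simp add: du mult.assoc) (simp add: um u_def[symmetric] mult.assoc[symmetric])
        then show ?thesis using False L(4) duI
          by (simp add: D2_def idm_Suc distrib_left left_diff_distrib mult.assoc) (simp add: u_def[symmetric])
      qed
      moreover have "D2 * idm d = D2"
        using L(5) by (simp add: D2_def left_diff_distrib du mult.assoc)
      ultimately show ?thesis by blast
    qed
  qed
  from this[of d] show thesis using that by fastforce
qed

subsection \<open>Four projections with scalar sum\<close>

declare One_nat_def [simp del]

text \<open>The given strategy, the same strategy with the parties exchanged (\<open>C\<close>,
  \<open>A\<close>, \<open>dag \<Psi>\<close>) and the model are all instances, so the chain is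
  built once for all of them. \<open>\<epsilon>\<close> is the sign supplied by the rank
  condition.\<close>

locale quadruple =
  fixes n :: nat and A C :: "nat \<Rightarrow> fmat" and \<Psi> :: fmat and \<epsilon> :: real
  assumes n_pos: "n \<ge> 1"
    and eps: "\<epsilon> * \<epsilon> = 1"
    and dagA: "\<And>i. i < 4 \<Longrightarrow> dag (A i) = A i"
    and dagC: "\<And>i. i < 4 \<Longrightarrow> dag (C i) = C i"
    and inter: "\<And>i. i < 4 \<Longrightarrow> A i * \<Psi> = \<Psi> * C i"
    and idem: "\<And>i. i < 4 \<Longrightarrow> A i * (A i * \<Psi>) = A i * \<Psi>"
    and sumA: "(A 0 + A 1 + A 2 + A 3) * \<Psi> = (2 - 1 / real n) *\<^sub>R \<Psi>"
    and normalized: "trR (dag \<Psi> * \<Psi>) = 1"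
    and weight: "trR (dag \<Psi> * (A 0 - A 1) * \<Psi>) = \<epsilon> / real n"
begin

definition PI :: fmat where "PI = rproj \<Psi>"

definition a :: "nat \<Rightarrow> fmat" where "a i = A i * PI"

definition X :: fmat where "X = a 0 + a 1 - PI"

definition Y :: fmat where "Y = a 0 - a 1"

definition Y' :: fmat where "Y' = a 2 - a 3"

text \<open>As \<open>X\<close> is self-adjoint and lives on the range of \<open>\<Psi>\<close>,
  this is the projection onto the kernel of \<open>X\<close> within that range.\<close>

definition E :: fmat where "E = PI - rproj X"

definition hop :: "nat \<Rightarrow> fmat" where "hop k = (if even k then Y' else Y)"

text \<open>Amplitude of the step out of position \<open>k\<close> of the chain; it becomes 0 at
  \<open>k = n - 1\<close>, which ends the chain.\<close>

definition s :: "nat \<Rightarrow> real" where "s k = sqrt (1 - (real (Suc k) / real n)\<^sup>2)"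

text \<open>Eigenvalue of \<open>X\<close> at position \<open>k\<close>: alternating the reflections
  x -> -x - 2/n and x -> -x from 0 produces 0, -2/n, 2/n, -4/n, 4/n and so on.\<close>

definition x :: "nat \<Rightarrow> real" where
  "x k = (if even k then real k / real n else - real (Suc k) / real n)"

text \<open>For \<open>k < n\<close> these are partial isometries carrying the kernel of
  \<open>X\<close> into the eigenspace for \<open>x k\<close>, as \<open>H_norm\<close> and
  \<open>X_H\<close> record.\<close>

primrec H :: "nat \<Rightarrow> fmat" where
  "H 0 = E"
| "H (Suc k) = (1 / s k) *\<^sub>R (hop k * H k)"

section \<open>Compression to the range of \<Psi>\<close>

lemma PI_Psi [simp]: "PI * \<Psi> = \<Psi>"
  and dag_PI [simp]: "dag PI = PI"
  and PI_PI [simp]: "PI * PI = PI"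
  by (simp_all add: PI_def)

lemma PI_range: obtains Z where "PI = \<Psi> * Z"
  using rproj_range PI_def by auto

text \<open>An identity tested on \<open>\<Psi>\<close> holds on its whole range, since
  \<open>PI\<close> factors as \<open>\<Psi> * Z\<close>.\<close>

lemma Psi_cancel: "Q * \<Psi> = R * \<Psi> \<Longrightarrow> Q * PI = R * PI"
  by (metis PI_range mult.assoc)

text \<open>\<open>A i * \<Psi> = \<Psi> * C i\<close> makes the range of \<open>\<Psi>\<close>
  invariant under \<open>A i\<close>; self-adjointness turns this into commutation with
  \<open>PI\<close>.\<close>

lemma PI_A: "i < 4 \<Longrightarrow> PI * A i = a i"
  and PI_a [simp]: "i < 4 \<Longrightarrow> PI * a i = a i"
proof -
  assume i: "i < 4"
  have "PI * A i * PI = A i * PI"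
    by (rule Psi_cancel) (simp add: mult.assoc inter[OF i], simp add: mult.assoc[symmetric])
  then have 1: "PI * a i = a i" by (simp add: a_def mult.assoc)
  then show "PI * a i = a i" .
  have "dag (PI * a i) = PI * a i" by (simp add: a_def dagA[OF i] mult.assoc)
  then show "PI * A i = a i" using 1 by (metis a_def dagA dag_PI dag_times i)
qed

lemma a_PI [simp]: "a i * PI = a i"
  by (simp add: a_def mult.assoc)

lemma dag_a [simp]: "i < 4 \<Longrightarrow> dag (a i) = a i"
  using PI_A by (simp add: a_def dagA)

lemma a_Psi: "a i * \<Psi> = A i * \<Psi>"
  by (simp add: a_def mult.assoc)

lemma a_idem: "i < 4 \<Longrightarrow> a i * a i = a i"
proof -
  assume i: "i < 4"
  have "A i * A i * PI = A i * PI"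
    by (rule Psi_cancel) (simp add: mult.assoc idem[OF i])
  then show ?thesis
    by (metis a_def PI_a i mult.assoc)
qed

lemma a_sum: "a 0 + a 1 + a 2 + a 3 = (2 - 1 / real n) *\<^sub>R PI"
proof -
  have "(A 0 + A 1 + A 2 + A 3) * PI = ((2 - 1 / real n) *\<^sub>R PI) * PI"
    by (rule Psi_cancel) (simp add: sumA)
  then show ?thesis by (simp add: a_def distrib_right)
qed

text \<open>Crossing \<open>\<Psi>\<close> turns \<open>A i\<close> into \<open>C i\<close>, which
  cyclicity of the trace carries to the other end, where it crosses \<open>dag \<Psi>\<close>
  back.\<close>

lemma trace_commute: "i < 4 \<Longrightarrow> trR (dag \<Psi> * (Q * a i) * \<Psi>) = trR (dag \<Psi> * (a i * Q) * \<Psi>)"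
proof -
  assume i: "i < 4"
  have "dag (A i * \<Psi>) = dag (\<Psi> * C i)" using inter[OF i] by simp
  then have 1: "dag \<Psi> * A i = C i * dag \<Psi>" using i by (simp add: dagA dagC)
  have "trR (dag \<Psi> * (Q * a i) * \<Psi>) = trR ((dag \<Psi> * Q * \<Psi>) * C i)"
    by (simp add: mult.assoc a_Psi inter[OF i])
  also have "\<dots> = trR (dag \<Psi> * A i * Q * \<Psi>)"
    by (subst trR_commute) (simp add: mult.assoc[symmetric] 1)
  also have "dag \<Psi> * A i = dag \<Psi> * a i"
  proof -
    have "dag \<Psi> * PI = dag \<Psi>" by (metis PI_Psi dag_PI dag_times)
    then show ?thesis by (metis PI_A i mult.assoc)
  qed
  finally show ?thesis by (simp add: mult.assoc)
qed

section \<open>Relations among X, Y and Y'\<close>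

lemma corner [simp]:
  "PI * X = X" "X * PI = X" "PI * Y = Y" "Y * PI = Y" "PI * Y' = Y'" "Y' * PI = Y'"
  "dag X = X" "dag Y = Y" "dag Y' = Y'"
  by (simp_all add: X_def Y_def Y'_def algebra_simps)

lemma XY: "X * Y = - (Y * X)"
  by (simp add: X_def Y_def algebra_simps a_idem)

lemma YY: "Y * Y = PI - X * X"
  by (simp add: X_def Y_def algebra_simps a_idem)

lemma X_complement: "a 2 + a 3 - PI = - (1 / real n) *\<^sub>R PI - X"
proof -
  have "a 2 + a 3 - PI = (a 0 + a 1 + a 2 + a 3) - a 0 - a 1 - PI" by simp
  then show ?thesis by (simp add: a_sum X_def scaleR_left_diff_distrib scaleR_2)
qed

lemma double_scaleR: "(2 / real n) *\<^sub>R M = (1 / real n) *\<^sub>R M + (1 / real n) *\<^sub>R M" for M :: fmat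
  by (simp flip: scaleR_left_distrib)

text \<open>The second pair of projections anticommutes in the same way with
  \<open>a 2 + a 3 - PI\<close>, which by the sum condition is \<open>- X\<close> shifted by
  -1/n.\<close>

lemma XY': "X * Y' = - (Y' * X) - (2 / real n) *\<^sub>R Y'"
proof -
  have "(a 2 + a 3 - PI) * Y' = - (Y' * (a 2 + a 3 - PI))"
    by (simp add: Y'_def algebra_simps a_idem)
  then show ?thesis
    unfolding X_complement by (simp add: double_scaleR algebra_simps eq_neg_iff_add_eq_0 neg_eq_iff_add_eq_0)
qed

lemma Y'Y': "Y' * Y' = PI - (X * X + (2 / real n) *\<^sub>R X + (1 / real n)\<^sup>2 *\<^sub>R PI)"
proof -
  have "Y' * Y' = PI - (a 2 + a 3 - PI) * (a 2 + a 3 - PI)"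
    by (simp add: Y'_def algebra_simps a_idem)
  then show ?thesis
    unfolding X_complement by (simp add: double_scaleR algebra_simps power2_eq_square)
qed

end

section \<open>The chain of eigenspaces starting from the kernel of X\<close>

context quadruple begin

lemma E_facts [simp]:
  "dag E = E" "E * E = E" "E * X = 0" "X * E = 0" "PI * E = E" "E * PI = E"
proof -
  obtain Z where Z: "rproj X = X * Z" using rproj_range by blast
  have X: "X * rproj X = X"
    by (metis corner(7) dag_rproj dag_times rproj_times)
  have 1: "PI * rproj X = rproj X" by (simp add: Z mult.assoc[symmetric])
  then have 2: "rproj X * PI = rproj X"
    by (metis dag_PI dag_rproj dag_times)
  show "dag E = E" "E * E = E" "E * X = 0" "X * E = 0" "PI * E = E" "E * PI = E"
    by (simp_all add: E_def left_diff_distrib right_diff_distrib 1 2 X)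
qed

text \<open>Inverts \<open>X\<close> off its kernel, with \<open>W = dag Z * X * Z\<close> where
  \<open>rproj X = X * Z\<close>; multiplying by \<open>W\<close> shows that whatever
  \<open>X\<close> annihilates lies in the range of \<open>E\<close>.\<close>

lemma X_pseudo_inverse:
  obtains W where "X * W = PI - E" "W * X = PI - E"
proof -
  obtain Z where Z: "rproj X = X * Z" using rproj_range by blast
  have X: "X * rproj X = X"
    by (metis corner(7) dag_rproj dag_times rproj_times)
  have R: "dag Z * X = rproj X"
    by (metis Z corner(7) dag_rproj dag_times)
  have "X * (dag Z * X * Z) = rproj X"
    by (simp add: R X[folded mult.assoc] mult.assoc[symmetric] X) (simp add: Z)
  moreover have "dag Z * X * Z * X = rproj X"
    by (metis R Z mult.assoc rproj_times)
  ultimately show thesis using that by (simp add: E_def)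
qed

lemma hop_facts [simp]:
  "dag (hop k) = hop k" "PI * hop k = hop k" "hop k * PI = hop k"
  by (simp_all add: hop_def)

lemma PI_H [simp]: "PI * H k = H k"
  by (induction k) (simp_all add: mult.assoc[symmetric])

lemma X_H: "X * H k = x k *\<^sub>R H k"
proof (induction k)
  case 0
  then show ?case by (simp add: x_def)
next
  case (Suc k)
  have "X * (hop k * H k) = x (Suc k) *\<^sub>R (hop k * H k)"
  proof (cases "even k")
    case True
    have "X * (Y' * H k) = - (Y' * (X * H k)) - (2 / real n) *\<^sub>R (Y' * H k)"
      by (simp only: mult.assoc[symmetric] XY' left_diff_distrib minus_mult_left mult_scaleR_left)
    also have "\<dots> = (- x k - 2 / real n) *\<^sub>R (Y' * H k)"
      by (simp add: Suc.IH scaleR_left_diff_distrib)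
    also have "- x k - 2 / real n = x (Suc k)"
      using True n_pos by (simp add: x_def field_simps)
    finally show ?thesis using True by (simp add: hop_def)
  next
    case False
    have "X * (Y * H k) = - (Y * (X * H k))"
      by (simp only: mult.assoc[symmetric] XY minus_mult_left)
    also have "\<dots> = (- x k) *\<^sub>R (Y * H k)"
      by (simp add: Suc.IH)
    also have "- x k = x (Suc k)"
      using False n_pos by (simp add: x_def field_simps)
    finally show ?thesis using False by (simp add: hop_def)
  qed
  then show ?case by simp
qed

lemma s_sq: "k < n \<Longrightarrow> (s k)\<^sup>2 = 1 - (real (Suc k) / real n)\<^sup>2"
  using n_pos unfolding s_def by (subst real_sqrt_pow2) (auto simp: power_le_one)

lemma s_pos: "Suc k < n \<Longrightarrow> 0 < s k"
  unfolding s_def by (simp add: power_less_one_iff abs_square_less_1 del: of_nat_Suc)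

lemma s_last: "Suc k = n \<Longrightarrow> s k = 0"
  by (auto simp: s_def)

text \<open>On an eigenspace of \<open>X\<close>, \<open>Y * Y\<close> is one minus the squared
  eigenvalue, and \<open>Y' * Y'\<close> is the same with the eigenvalue shifted by 1/n; for the
  parity at which each is used, the square is ((k + 1)/n)^2.\<close>

lemma hop_hop_H:
  assumes "k < n"
  shows "hop k * (hop k * H k) = (s k)\<^sup>2 *\<^sub>R H k"
proof -
  have XX: "X * (X * H k) = (x k)\<^sup>2 *\<^sub>R H k" by (simp add: X_H power2_eq_square)
  show ?thesis
  proof (cases "even k")
    case True
    have "Y' * (Y' * H k) = H k - ((x k)\<^sup>2 *\<^sub>R H k + (2 / real n) *\<^sub>R x k *\<^sub>R H k + (1 / real n)\<^sup>2 *\<^sub>R H k)"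
      by (subst mult.assoc[symmetric], subst Y'Y')
        (simp only: left_diff_distrib distrib_right mult.assoc X_H mult_scaleR_left
          mult_scaleR_right scaleR_scaleR power2_eq_square PI_H)
    also have "\<dots> = (1 - ((x k)\<^sup>2 + 2 / real n * x k + (1 / real n)\<^sup>2)) *\<^sub>R H k"
      by (simp add: scaleR_left_diff_distrib scaleR_left_distrib)
    also have "1 - ((x k)\<^sup>2 + 2 / real n * x k + (1 / real n)\<^sup>2) = (s k)\<^sup>2"
      unfolding s_sq[OF assms] using True n_pos by (simp add: x_def field_simps power2_eq_square)
    finally show ?thesis using True by (simp add: hop_def)
  next
    case False
    have "Y * (Y * H k) = H k - (x k)\<^sup>2 *\<^sub>R H k"
      by (subst mult.assoc[symmetric], subst YY)
        (simp only: left_diff_distrib mult.assoc XX PI_H)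
    also have "\<dots> = (1 - (x k)\<^sup>2) *\<^sub>R H k"
      by (simp add: scaleR_left_diff_distrib)
    also have "1 - (x k)\<^sup>2 = (s k)\<^sup>2"
      unfolding s_sq[OF assms] using False
      by (simp add: x_def power_divide power2_eq_square algebra_simps)
    finally show ?thesis using False by (simp add: hop_def)
  qed
qed

lemma hop_H: "Suc k < n \<Longrightarrow> hop k * H k = s k *\<^sub>R H (Suc k)"
  using s_pos[of k] by simp

lemma hop_H_Suc: "Suc k < n \<Longrightarrow> hop k * H (Suc k) = s k *\<^sub>R H k"
  using s_pos[of k] hop_hop_H[of k] by (simp add: power2_eq_square)

lemma hop_H_last:
  assumes "Suc k = n"
  shows "hop k * H k = 0"
proof -
  have "dag (hop k * H k) * (hop k * H k) = 0"
    using hop_hop_H[of k] assms s_last[OF assms] by (simp add: mult.assoc)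
  then show ?thesis using trR_dag_self_eq_0 by (metis trR_linear(1))
qed

lemma H_norm: "k < n \<Longrightarrow> dag (H k) * H k = E"
proof (induction k)
  case (Suc k)
  have s: "s k \<noteq> 0" using s_pos[OF Suc.prems] by simp
  have "dag (H (Suc k)) * H (Suc k) = (1 / (s k)\<^sup>2) *\<^sub>R (dag (H k) * (hop k * (hop k * H k)))"
    by (simp add: mult.assoc power2_eq_square)
  also have "\<dots> = E" using s Suc by (simp add: hop_hop_H)
  finally show ?case .
qed simp

lemma x_inj: "x k = x l \<Longrightarrow> k = l"
  using n_pos by (auto simp: x_def split: if_splits)

lemma H_orth: "k \<noteq> l \<Longrightarrow> dag (H k) * H l = 0"
proof -
  assume "k \<noteq> l"
  then have ne: "x k - x l \<noteq> 0" using x_inj by auto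
  have "dag (H k) * X = x k *\<^sub>R dag (H k)"
    using arg_cong[OF X_H[of k], of dag] by simp
  then have "x k *\<^sub>R (dag (H k) * H l) = dag (H k) * X * H l" by simp
  also have "\<dots> = x l *\<^sub>R (dag (H k) * H l)" by (simp add: mult.assoc X_H)
  finally have "(x k - x l) *\<^sub>R (dag (H k) * H l) = 0" by (simp add: scaleR_left_diff_distrib)
  then show ?thesis using ne by simp
qed

text \<open>\<open>Y\<close> anticommutes with \<open>X\<close> and hence preserves its kernel;
  self-adjointness of \<open>Y\<close> gives the commutation with \<open>E\<close>.\<close>

lemma E_Y: "E * (Y * E) = Y * E" "E * Y = Y * E"
proof -
  obtain W where W: "X * W = PI - E" "W * X = PI - E" using X_pseudo_inverse by blast
  have "X * (Y * E) = 0" by (simp add: mult.assoc[symmetric] XY) (simp add: mult.assoc)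
  then have "(PI - E) * (Y * E) = 0" by (metis W(2) mult.assoc mult_zero_right)
  then show 1: "E * (Y * E) = Y * E" by (simp add: left_diff_distrib mult.assoc[symmetric])
  have "E * (Y * E) = E * Y" using arg_cong[OF 1, of dag] by (simp add: mult.assoc)
  then show "E * Y = Y * E" using 1 by simp
qed

section \<open>The tracial weight and the extremal case\<close>

definition \<tau> :: "fmat \<Rightarrow> real" where "\<tau> Q = trR (dag \<Psi> * Q * \<Psi>)"

lemma tau_linear [simp]:
  "\<tau> (Q + R) = \<tau> Q + \<tau> R" "\<tau> (Q - R) = \<tau> Q - \<tau> R" "\<tau> (- Q) = - \<tau> Q" "\<tau> (r *\<^sub>R Q) = r * \<tau> Q"
  by (simp_all add: \<tau>_def algebra_simps)

lemma tau_sum: "\<tau> (\<Sum>x\<in>S. f x) = (\<Sum>x\<in>S. \<tau> (f x))"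
  by (simp add: \<tau>_def sum_distrib_left sum_distrib_right trR_sum)

lemma tau_pos: "0 \<le> \<tau> (dag Q * Q)"
  using trR_dag_self_nonneg[of "Q * \<Psi>"] by (simp add: \<tau>_def mult.assoc)

text \<open>The weight sees only the range of \<open>\<Psi>\<close>, hence the factor
  \<open>PI\<close>.\<close>

lemma tau_faithful: "\<tau> (dag Q * Q) = 0 \<Longrightarrow> Q * PI = 0"
  using trR_dag_self_eq_0[of "Q * \<Psi>"] Psi_cancel[of Q 0] by (simp add: \<tau>_def mult.assoc)

lemma tau_a: "i < 4 \<Longrightarrow> \<tau> (Q * a i) = \<tau> (a i * Q)"
  using trace_commute by (simp add: \<tau>_def)

lemma tau_PI: "\<tau> (Q * PI) = \<tau> Q" "\<tau> (PI * Q) = \<tau> Q"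
proof -
  show "\<tau> (Q * PI) = \<tau> Q" by (simp add: \<tau>_def mult.assoc)
  have "dag \<Psi> * PI = dag \<Psi>" by (metis PI_Psi dag_PI dag_times)
  then show "\<tau> (PI * Q) = \<tau> Q" by (simp add: \<tau>_def mult.assoc[symmetric])
qed

lemma tau_gens: "\<tau> (Q * X) = \<tau> (X * Q)" "\<tau> (Q * Y) = \<tau> (Y * Q)" "\<tau> (Q * hop k) = \<tau> (hop k * Q)"
  by (simp_all add: X_def Y_def Y'_def hop_def distrib_left distrib_right left_diff_distrib
      right_diff_distrib tau_a tau_PI)

text \<open>Traciality moves one \<open>hop k\<close> next to the other, so successive chain
  positions have the same weight.\<close>

lemma tau_H: "k < n \<Longrightarrow> \<tau> (H k * dag (H k)) = \<tau> E"
proof (induction k)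
  case (Suc k)
  have s: "s k \<noteq> 0" using s_pos[OF Suc.prems] by simp
  have "\<tau> (H (Suc k) * dag (H (Suc k))) = (1 / (s k)\<^sup>2) * \<tau> (hop k * H k * dag (H k) * hop k)"
    by (simp add: mult.assoc power2_eq_square)
  also have "\<tau> (hop k * H k * dag (H k) * hop k) = \<tau> (hop k * (hop k * H k) * dag (H k))"
    using tau_gens(3)[of "hop k * H k * dag (H k)" k] by (simp add: mult.assoc)
  also have "\<dots> = (s k)\<^sup>2 * \<tau> (H k * dag (H k))"
    using Suc.prems by (simp add: hop_hop_H)
  finally show ?case using s Suc by simp
qed simp

lemma tau_1: "\<tau> PI = 1"
  using normalized by (simp add: \<tau>_def mult.assoc)

lemma tau_Y: "\<tau> Y = \<epsilon> / real n"
  using weight by (simp add: \<tau>_def Y_def a_Psi mult.assoc left_diff_distrib)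

text \<open>\<open>Y\<close> anticommutes with \<open>X\<close>, so it has no trace off the kernel of \<open>X\<close>.\<close>
lemma tau_YE: "\<tau> (Y * E) = \<epsilon> / real n"
proof -
  obtain W where W: "X * W = PI - E" "W * X = PI - E" using X_pseudo_inverse by blast
  have "\<tau> (Y * (X * W)) = - \<tau> (X * (Y * W))"
    by (simp only: mult.assoc[symmetric] XY minus_mult_left minus_minus flip: tau_linear(3))
  \<comment> \<open>\<open>W\<close> inverts \<open>X\<close> from both sides off the kernel, so
    cyclicity returns to the starting expression, now with opposite sign.\<close>
  also have "\<tau> (X * (Y * W)) = \<tau> (Y * (X * W))"
    by (simp add: tau_gens(1)[symmetric] W mult.assoc)
  finally have "\<tau> (Y * (PI - E)) = 0" by (simp add: W)
  then show ?thesis by (simp add: right_diff_distrib tau_Y)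
qed

lemma sum_H_adjoint:
  "dag (\<Sum>k<n. H k * dag (H k)) = (\<Sum>k<n. H k * dag (H k))"
  by (simp add: dag_sum)

lemma H_E [simp]: "H k * E = H k"
  by (induction k) (simp_all add: mult.assoc)

lemma sum_H_times_H: "l < n \<Longrightarrow> (\<Sum>k<n. H k * dag (H k)) * H l = H l"
proof -
  assume l: "l < n"
  have "(\<Sum>k<n. H k * dag (H k)) * H l = (\<Sum>k<n. if k = l then H l else 0)"
    unfolding sum_distrib_right
    by (rule sum.cong) (use H_norm H_orth in \<open>auto simp: mult.assoc\<close>)
  then show ?thesis using l by simp
qed

text \<open>\<open>D\<close> is twice a projection and \<open>PI - S\<close> is one, so both have nonnegative weight; these weights
  are \<open>\<tau> E - 1/n\<close> and \<open>1 - n * \<tau> E\<close>, which forces both to vanish.\<close>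
lemma extremal: "\<tau> E = 1 / real n" "Y * E = \<epsilon> *\<^sub>R E" "(\<Sum>k<n. H k * dag (H k)) = PI"
proof -
  define S where "S = (\<Sum>k<n. H k * dag (H k))"
  define D where "D = E - \<epsilon> *\<^sub>R (Y * E)"
  have YYE: "Y * (Y * E) = E"
    by (simp add: mult.assoc[symmetric] YY left_diff_distrib) (simp add: mult.assoc)
  have "dag D * D = D + D"
    by (simp add: D_def E_Y left_diff_distrib right_diff_distrib mult.assoc YYE eps
        scaleR_right_diff_distrib)
  then have D: "\<tau> (dag D * D) = 2 * (\<tau> E - 1 / real n)"
    by (simp add: D_def tau_YE eps)
  have dS: "dag S = S" unfolding S_def by (rule sum_H_adjoint)
  have SS: "S * S = S"
  proof -
    have "S * S = (\<Sum>k<n. S * H k * dag (H k))"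
      by (subst (2) S_def) (simp add: sum_distrib_left mult.assoc)
    also have "\<dots> = S" unfolding S_def by (intro sum.cong refl) (simp add: sum_H_times_H)
    finally show ?thesis .
  qed
  have PS: "PI * S = S" by (simp add: S_def sum_distrib_left mult.assoc[symmetric])
  then have SP: "S * PI = S" using dS by (metis dag_PI dag_times)
  have "dag (PI - S) * (PI - S) = PI - S"
    by (simp add: dS left_diff_distrib right_diff_distrib SS PS SP)
  moreover have "\<tau> S = real n * \<tau> E"
    by (simp add: S_def tau_sum tau_H)
  ultimately have S: "\<tau> (dag (PI - S) * (PI - S)) = 1 - real n * \<tau> E"
    by (simp add: tau_1)
  have "\<tau> E \<ge> 1 / real n" using tau_pos[of D] D by simp
  moreover have "real n * \<tau> E \<le> 1" using tau_pos[of "PI - S"] S by simp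
  then have "\<tau> E \<le> 1 / real n" using n_pos by (simp add: field_simps)
  ultimately show E: "\<tau> E = 1 / real n" by simp
  \<comment> \<open>Zero weight forces \<open>D = 0\<close>, that is, \<open>Y\<close> acts on the
    kernel of \<open>X\<close> as the scalar \<open>\<epsilon>\<close>.\<close>
  have "D * PI = 0" by (rule tau_faithful) (simp add: D E)
  then have "D = 0" by (simp add: D_def left_diff_distrib mult.assoc)
  then have "E = \<epsilon> *\<^sub>R (Y * E)" by (simp add: D_def)
  from arg_cong[OF this, of "scaleR \<epsilon>"] show "Y * E = \<epsilon> *\<^sub>R E"
    by (simp only: scaleR_scaleR eps scaleR_one)
  have "(PI - S) * PI = 0" by (rule tau_faithful, unfold S E) (use n_pos in simp)
  then show "(\<Sum>k<n. H k * dag (H k)) = PI" by (simp add: left_diff_distrib SP S_def[symmetric])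
qed

end

subsection \<open>Dilation to the model projections\<close>

context quadruple begin

text \<open>With a Boolean index, \<open>Z (even k)\<close> is \<open>hop k\<close>, so forward and
  backward steps along the chain share one formula.\<close>

definition Z :: "bool \<Rightarrow> fmat" where "Z b = (if b then Y' else Y)"

text \<open>Each of \<open>Y'\<close> and \<open>Y\<close> pairs up neighbours of the chain \<open>H\<close>. The ends are fixed: index 0 through
  truncated subtraction (with amplitude \<open>\<epsilon>\<close>), index \<open>n - 1\<close> with amplitude 0.\<close>
definition partner :: "bool \<Rightarrow> nat \<Rightarrow> nat" where
  "partner b k = (if even k = b then (if Suc k < n then Suc k else k) else k - 1)"

definition amp :: "bool \<Rightarrow> nat \<Rightarrow> real" where
  "amp b k = (if even k = b then s k else if k = 0 then \<epsilon> else s (k - 1))"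

text \<open>When the parity of \<open>k\<close> matches \<open>b\<close> the step goes forward,
  otherwise back along the previous step. The coefficients involve only \<open>n\<close> and
  \<open>\<epsilon>\<close>, so they are the same for the strategy and the model.\<close>

lemma Z_H:
  assumes "k < n"
  shows "Z b * H k = amp b k *\<^sub>R H (partner b k)"
proof (cases "even k = b")
  case True
  then have Z: "Z b = hop k" by (auto simp: Z_def hop_def)
  show ?thesis
  proof (cases "Suc k < n")
    case True
    then show ?thesis using \<open>even k = b\<close> by (simp only: Z hop_H) (simp add: partner_def amp_def)
  next
    case False
    then have "Suc k = n" using assms by simp
    then show ?thesis using True False by (simp add: Z hop_H_last partner_def amp_def s_last)
  qed
next
  case False
  show ?thesis
  proof (cases k)
    case 0
    then show ?thesis using False extremal(2) by (auto simp: Z_def partner_def amp_def)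
  next
    case (Suc j)
    then have "Z b = hop j" using False by (auto simp: Z_def hop_def)
    then show ?thesis using Suc False assms
      by (simp only: Suc hop_H_Suc) (simp add: partner_def amp_def)
  qed
qed

lemma partner:
  assumes "k < n"
  shows "partner b k < n" "partner b (partner b k) = k" "amp b (partner b k) = amp b k"
  using assms by (cases k; auto simp: partner_def amp_def)+

lemma H_PI [simp]: "H k * PI = H k"
  by (metis H_E E_facts(6) mult.assoc)

lemma a_XYZ:
  "a 0 = (1/2) *\<^sub>R (X + Z False + PI)" "a 1 = (1/2) *\<^sub>R (X - Z False + PI)"
  "a 2 = (1/2) *\<^sub>R (- (1 / real n) *\<^sub>R PI - X + Z True + PI)"
  "a 3 = (1/2) *\<^sub>R (- (1 / real n) *\<^sub>R PI - X - Z True + PI)"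
  unfolding X_complement[symmetric]
  by (simp_all add: X_def Y_def Y'_def Z_def flip: scaleR_2)

lemma dag_Z [simp]: "dag (Z b) = Z b"
  by (simp add: Z_def)

end

text \<open>\<open>P\<close> on the family \<open>F\<close> and \<open>Q\<close> on the family
  \<open>G\<close> act by the same weighted involution, so reindexing by \<open>\<sigma>\<close>
  moves the operator from left to right.\<close>

lemma intertwine:
  fixes F G :: "nat \<Rightarrow> fmat"
  assumes \<sigma>: "\<And>k. k < n \<Longrightarrow> \<sigma> k < n" "\<And>k. k < n \<Longrightarrow> \<sigma> (\<sigma> k) = k" "\<And>k. k < n \<Longrightarrow> m (\<sigma> k) = m k"
    and F: "\<And>k. k < n \<Longrightarrow> P * F k = m k *\<^sub>R F (\<sigma> k)"
    and G: "\<And>k. k < n \<Longrightarrow> Q * G k = m k *\<^sub>R G (\<sigma> k)" and "dag Q = Q"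
  shows "P * (\<Sum>k<n. F k * w * dag (G k)) = (\<Sum>k<n. F k * w * dag (G k)) * Q"
proof -
  have G': "dag (G k) * Q = m k *\<^sub>R dag (G (\<sigma> k))" if "k < n" for k
    using arg_cong[OF G[OF that], of dag] \<open>dag Q = Q\<close> by simp
  have "P * (\<Sum>k<n. F k * w * dag (G k)) = (\<Sum>k<n. m k *\<^sub>R (F (\<sigma> k) * w * dag (G k)))"
    by (auto simp: sum_distrib_left F mult.assoc[symmetric] intro!: sum.cong)
  also have "\<dots> = (\<Sum>k<n. m k *\<^sub>R (F k * w * dag (G (\<sigma> k))))"
    by (rule sum.reindex_bij_witness[of _ \<sigma> \<sigma>]) (auto simp: \<sigma>)
  also have "\<dots> = (\<Sum>k<n. F k * w * dag (G k)) * Q"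
    by (auto simp: sum_distrib_right G' mult.assoc intro!: sum.cong)
  finally show ?thesis .
qed

text \<open>\<open>V k\<close> is the matrix unit that sends the basis vector \<open>k\<close> to the unit vector spanning the
  one-dimensional range of \<open>P.E\<close>.\<close>
locale dilation_pair = L: quadruple n A C \<Psi> \<epsilon> + P: quadruple n P P "(1 / sqrt (real n)) *\<^sub>R idm n" \<epsilon>
  for n A C \<Psi> \<epsilon> P +
  fixes d :: nat and V :: "nat \<Rightarrow> fmat"
  assumes supp: "idm d * \<Psi> = \<Psi>"
    and P_supp: "\<And>i. i < 4 \<Longrightarrow> P i * idm n = P i"
    and V_dag: "\<And>k l. dag (V k) * V l = munit k l"
    and E_V: "\<And>k. P.E * V k = V k"
    and V_V: "\<And>k l M. V k * M * dag (V l) = cscale (ent M k l) P.E"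
begin

text \<open>Slice \<open>k\<close> of a map from the range of \<open>\<Psi>\<close> to the model
  space tensored with the kernel of \<open>X\<close>: \<open>dag (L.H l)\<close> returns to the
  kernel, \<open>V k\<close> reads off coordinate \<open>k\<close> there, and \<open>P.H l\<close>
  climbs to the same position of the model chain.\<close>

definition T0 :: "nat \<Rightarrow> fmat" where
  "T0 k = (\<Sum>l<n. P.H l * V k * dag (L.H l))"

text \<open>The second term makes the map isometric off the range of \<open>\<Psi>\<close>.\<close>
definition T :: "nat \<Rightarrow> fmat" where
  "T k = T0 k + V k * (idm d - L.PI)"

lemma P_PI: "P.PI = idm n"
proof -
  have n: "sqrt (real n) \<noteq> 0" using P.n_pos by simp
  have 1: "P.PI * idm n = idm n"
    using P.PI_Psi n by simp
  have "idm n * P.PI = P.PI"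
    by (rule P.PI_range) (simp add: mult.assoc[symmetric])
  then show ?thesis using 1 by (metis P.dag_PI dag_idm dag_times)
qed

lemma P_a: "i < 4 \<Longrightarrow> P.a i = P i"
  by (simp add: P.a_def P_PI P_supp)

lemma idm_PI: "idm d * L.PI = L.PI" "L.PI * idm d = L.PI"
proof -
  show 1: "idm d * L.PI = L.PI"
    by (rule L.PI_range) (simp add: mult.assoc[symmetric] supp)
  then show "L.PI * idm d = L.PI" by (metis L.dag_PI dag_idm dag_times)
qed

lemma H_idm: "L.H k * idm d = L.H k"
  by (metis L.H_PI idm_PI(2) mult.assoc)

lemma T0_PI: "T0 k * L.PI = T0 k" "P.PI * T0 k = T0 k"
proof -
  have "dag (L.H l) * L.PI = dag (L.H l)" for l
    by (metis L.PI_H L.dag_PI dag_times)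
  then show "T0 k * L.PI = T0 k" by (simp add: T0_def sum_distrib_right mult.assoc)
  show "P.PI * T0 k = T0 k" by (simp add: T0_def sum_distrib_left mult.assoc[symmetric])
qed

lemma T0_X: "P.X * T0 k = T0 k * L.X"
  unfolding T0_def by (rule intertwine[of n id L.x]) (auto simp: L.X_H P.X_H)

lemma T0_Z: "P.Z b * T0 k = T0 k * L.Z b"
  unfolding T0_def by (rule intertwine[of n "L.partner b" "L.amp b"]) (auto simp: L.partner L.Z_H P.Z_H)

text \<open>It suffices to intertwine \<open>X\<close>, \<open>Y\<close>, \<open>Y'\<close> and
  \<open>PI\<close>, of which the four projections are linear combinations.\<close>

lemma T0_a:
  assumes "i < 4"
  shows "P i * T0 k = T0 k * L.a i"
proof -
  have "i = 0 \<or> i = 1 \<or> i = 2 \<or> i = 3" using assms by auto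
  then have "P.a i * T0 k = T0 k * L.a i"
    by (elim disjE) (simp_all only: L.a_XYZ P.a_XYZ, simp_all add: distrib_left distrib_right
      left_diff_distrib right_diff_distrib T0_X T0_Z T0_PI)
  then show ?thesis using P_a[OF assms] by simp
qed

lemma T_Psi: "T k * \<Psi> = T0 k * \<Psi>"
  by (simp add: T_def distrib_right left_diff_distrib right_diff_distrib mult.assoc supp)

lemma T_A:
  assumes "i < 4"
  shows "T k * (A i * \<Psi>) = P i * (T k * \<Psi>)"
proof -
  have "idm d * (A i * \<Psi>) = A i * \<Psi>" "L.PI * (A i * \<Psi>) = A i * \<Psi>"
    using L.PI_a[OF assms] idm_PI(1) by (metis L.a_Psi mult.assoc)+
  then have "T k * (A i * \<Psi>) = T0 k * (A i * \<Psi>)"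
    by (simp add: T_def distrib_right left_diff_distrib right_diff_distrib mult.assoc)
  then show ?thesis
    by (simp only: T_Psi) (simp only: mult.assoc[symmetric] T0_a[OF assms], simp only: mult.assoc L.a_Psi)
qed

lemma T0_T0: "dag (T0 k) * T0 k = (\<Sum>l<n. L.H l * munit k k * dag (L.H l))"
proof -
  have VV: "dag (V k) * (V k * x) = munit k k * x" for x
    by (simp only: mult.assoc[symmetric] V_dag)
  have "dag (T0 k) * T0 k
    = (\<Sum>l<n. \<Sum>m<n. L.H l * dag (V k) * (dag (P.H l) * P.H m) * V k * dag (L.H m))"
    by (simp add: T0_def dag_sum sum_product mult.assoc)
  also have "\<dots> = (\<Sum>l<n. \<Sum>m<n. if m = l then L.H l * munit k k * dag (L.H l) else 0)"
  proof (intro sum.cong refl)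
    fix l m assume "l \<in> {..<n}" "m \<in> {..<n}"
    then show "L.H l * dag (V k) * (dag (P.H l) * P.H m) * V k * dag (L.H m)
        = (if m = l then L.H l * munit k k * dag (L.H l) else 0)"
      by (cases "m = l") (simp_all add: P.H_orth P.H_norm, simp add: mult.assoc E_V VV)
  qed
  finally show ?thesis by simp
qed

text \<open>The range of \<open>V k\<close> sits at position 0 of the model chain, so orthogonality
  leaves only \<open>l = 0\<close>.\<close>

lemma T0_V: "dag (T0 k) * V k = L.E * munit k k"
proof -
  have "dag (T0 k) * V k = (\<Sum>l<n. L.H l * dag (V k) * (dag (P.H l) * P.H 0) * V k)"
    by (simp add: T0_def dag_sum sum_distrib_right mult.assoc E_V)
  also have "\<dots> = (\<Sum>l<n. if l = 0 then L.E * munit k k else 0)"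
  proof (intro sum.cong refl)
    fix l
    show "L.H l * dag (V k) * (dag (P.H l) * P.H 0) * V k = (if l = 0 then L.E * munit k k else 0)"
      using P.H_orth[of l 0] by (cases "l = 0") (simp_all add: mult.assoc E_V V_dag del: P.H.simps(2))
  qed
  finally show ?thesis using L.n_pos by simp
qed

text \<open>Summing over \<open>k\<close> resolves the identity in the middle of each product: the
  chain terms add up to \<open>PI\<close>, the complementary ones to \<open>Q\<close>, and the mixed
  terms vanish as \<open>L.E\<close> then meets \<open>Q\<close>.\<close>

lemma T_isometry: "(\<Sum>k<d. dag (T k) * T k) = idm d"
proof -
  define Q where "Q = idm d - L.PI"
  have Q: "dag Q = Q" "idm d * Q = Q" "Q * idm d = Q" "Q * Q = Q" "L.E * Q = 0"
  proof -
    show "dag Q = Q" "idm d * Q = Q" "Q * idm d = Q" "Q * Q = Q"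
      by (simp_all add: Q_def left_diff_distrib right_diff_distrib idm_PI)
    have "L.E * idm d = L.E" by (metis H_idm L.H.simps(1))
    then show "L.E * Q = 0" by (simp add: Q_def right_diff_distrib)
  qed
  have QE: "Q * L.E = 0" using Q(1,5) by (metis L.E_facts(1) dag_linear(1) dag_times)
  have VT: "dag (V k) * T0 k = munit k k * L.E" for k
    using arg_cong[OF T0_V[of k], of dag] by simp
  have "dag (T k) * T k = (\<Sum>l<n. L.H l * munit k k * dag (L.H l)) + L.E * munit k k * Q
      + Q * munit k k * L.E + Q * munit k k * Q" for k
  proof -
    have "dag (T k) * T k = dag (T0 k) * T0 k + dag (T0 k) * V k * Q
        + Q * (dag (V k) * T0 k) + Q * (dag (V k) * V k) * Q"
      by (simp add: T_def Q_def[symmetric] Q(1) distrib_left distrib_right mult.assoc add.assoc)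
    then show ?thesis by (simp only: T0_T0 T0_V VT V_dag mult.assoc)
  qed
  then have "(\<Sum>k<d. dag (T k) * T k) = (\<Sum>l<n. L.H l * (\<Sum>k<d. munit k k) * dag (L.H l))
      + L.E * (\<Sum>k<d. munit k k) * Q + Q * (\<Sum>k<d. munit k k) * L.E + Q * (\<Sum>k<d. munit k k) * Q"
    by (simp add: sum.distrib sum_distrib_left sum_distrib_right)
      (subst sum.swap, simp)
  also have "\<dots> = L.PI + Q"
    by (simp add: sum_munit H_idm L.extremal(3) mult.assoc Q QE)
  finally show ?thesis by (simp add: Q_def)
qed

end

text \<open>\<open>\<Psi>\<close> intertwines Alice's chain with Bob's, so only equal positions
  overlap, each contributing \<open>L.E * \<Psi>\<close>. The transformed state is thus maximally
  entangled, tensored with a vector whose matrix is proportional to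
  \<open>L.E * \<Psi>\<close>.\<close>

lemma (in dilation_pair) T_Psi_T:
  assumes "dilation_pair n C A (dag \<Psi>) \<epsilon> P e V"
  shows "T k * \<Psi> * dag (dilation_pair.T n C (dag \<Psi>) P e V l) = cscale (ent (L.E * \<Psi>) k l) (idm n)"
proof -
  interpret R: dilation_pair n C A "dag \<Psi>" \<epsilon> P e V by fact
  have PsiPI: "\<Psi> * R.L.PI = \<Psi>"
    by (metis R.L.PI_Psi R.L.dag_PI dag_dag dag_times)
  have gens: "L.X * \<Psi> = \<Psi> * R.L.X" "L.hop j * \<Psi> = \<Psi> * R.L.hop j" for j
  proof -
    have a: "L.a i * \<Psi> = \<Psi> * R.L.a i" if "i < 4" for i
      using R.L.PI_A[OF that] L.inter[OF that] PsiPI by (metis L.a_Psi mult.assoc)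
    show "L.X * \<Psi> = \<Psi> * R.L.X" "L.hop j * \<Psi> = \<Psi> * R.L.hop j"
      by (simp_all add: L.X_def R.L.X_def L.hop_def R.L.hop_def L.Y_def R.L.Y_def L.Y'_def R.L.Y'_def
          a PsiPI distrib_left distrib_right left_diff_distrib right_diff_distrib)
  qed
  \<comment> \<open>\<open>\<Psi>\<close> carries the range of Bob's \<open>X\<close> into that of
    Alice's, which \<open>L.E\<close> annihilates.\<close>
  have E: "L.E * \<Psi> = L.E * \<Psi> * R.L.E"
  proof -
    obtain W where "R.L.X * W = R.L.PI - R.L.E" using R.L.X_pseudo_inverse by blast
    moreover have "L.E * \<Psi> * (R.L.X * W) = 0"
      by (metis L.E_facts(3) gens(1) mult.assoc mult_zero_left)
    ultimately show ?thesis using PsiPI by (simp add: right_diff_distrib mult.assoc)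
  qed
  have H: "dag (L.H j) * \<Psi> = L.E * \<Psi> * dag (R.L.H j)" for j
  proof (induction j)
    case 0
    then show ?case using E by simp
  next
    case (Suc j)
    have "dag (L.H j) * (L.hop j * \<Psi>) = L.E * (\<Psi> * (dag (R.L.H j) * R.L.hop j))"
      using Suc by (simp only: gens) (simp only: mult.assoc[symmetric])
    then show ?case by (simp add: mult.assoc)
  qed
  have HH: "dag (L.H i) * \<Psi> * R.L.H j = (if i = j then L.E * \<Psi> else 0)" if "i < n" "j < n" for i j
    using R.L.H_orth[of i j] R.L.H_norm[OF that(1)] E by (auto simp: H mult.assoc)
  have "T k * \<Psi> * dag (R.T l) = T0 k * \<Psi> * dag (R.T0 l)"
  proof -
    have "\<Psi> * dag (R.T l) = dag (R.T l * dag \<Psi>)" by simp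
    also have "\<dots> = \<Psi> * dag (R.T0 l)" by (simp only: R.T_Psi) simp
    finally have "\<Psi> * dag (R.T l) = \<Psi> * dag (R.T0 l)" .
    then show ?thesis using T_Psi by (metis mult.assoc)
  qed
  also have "\<dots> = (\<Sum>i<n. \<Sum>j<n. P.H i * (V k * (dag (L.H i) * \<Psi> * R.L.H j) * dag (V l)) * dag (P.H j))"
    by (simp add: T0_def R.T0_def dag_sum sum_distrib_right sum_distrib_left mult.assoc) (rule sum.swap)
  also have "\<dots> = (\<Sum>i<n. \<Sum>j<n. if j = i then P.H i * (V k * (L.E * \<Psi>) * dag (V l)) * dag (P.H i) else 0)"
    by (intro sum.cong refl) (auto simp: HH)
  also have "\<dots> = (\<Sum>i<n. cscale (ent (L.E * \<Psi>) k l) (P.H i * dag (P.H i)))"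
    by (simp add: V_V)
  also have "\<dots> = cscale (ent (L.E * \<Psi>) k l) (\<Sum>i<n. P.H i * dag (P.H i))"
    by (rule fmat_eqI) (simp add: ent_sum sum_distrib_left)
  finally show ?thesis by (simp add: P.extremal(3) P_PI)
qed

text \<open>In the model \<open>E\<close> has trace 1. For any \<open>j\<close> with
  \<open>E * munit j j\<close> nonzero, subtracting the normalized \<open>E * munit j j * E\<close>
  from \<open>E\<close> leaves a projection of trace 0, hence nothing.\<close>

lemma (in quadruple) rank_one:
  assumes "\<Psi> = (1 / sqrt (real n)) *\<^sub>R idm n"
  obtains j r where "0 < r" "munit j j * E * munit j j = r *\<^sub>R munit j j" "E * munit j j * E = r *\<^sub>R E"
proof -
  have PIn: "PI * idm n = idm n" using PI_Psi n_pos by (simp add: assms)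
  have "idm n * PI = PI"
    by (rule PI_range) (simp add: assms mult.assoc[symmetric])
  then have "PI = idm n" using PIn by (metis dag_PI dag_idm dag_times)
  then have En: "E * idm n = E" "idm n * E = E" using E_facts(5,6) by auto
  have "trR (dag \<Psi> * Q * \<Psi>) = 1 / real n * trR Q" if "Q * idm n = Q" "idm n * Q = Q" for Q
    using n_pos that by (simp add: assms)
  from this[OF En] have "1 / real n = 1 / real n * trR E"
    using extremal(1) by (simp add: \<tau>_def)
  then have tr1: "trR E = 1" using n_pos by simp
  have "\<exists>j. E * munit j j \<noteq> 0"
  proof (rule ccontr)
    assume "\<nexists>j. E * munit j j \<noteq> 0"
    then have "E * (\<Sum>j<n. munit j j) = 0" by (simp add: sum_distrib_left)
    then show False using tr1 by (simp add: sum_munit En)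
  qed
  then obtain j where j: "E * munit j j \<noteq> 0" by blast
  obtain r where r: "0 \<le> r" "dag (E * munit j j) * (E * munit j j) = r *\<^sub>R munit j j" "r = 0 \<longleftrightarrow> E * munit j j = 0"
  proof (rule dag_self_munit[of "E * munit j j" j])
    show "E * munit j j * munit j j = E * munit j j" by (simp add: mult.assoc)
  qed blast
  have r0: "0 < r" using r j by linarith
  have EE: "E * (E * Q) = E * Q" for Q by (simp add: mult.assoc[symmetric])
  have 1: "munit j j * E * munit j j = r *\<^sub>R munit j j"
    using r(2) by (simp add: mult.assoc EE)
  define D where "D = E - (1 / r) *\<^sub>R (E * munit j j * E)"
  have mEm: "munit j j * (E * (munit j j * Q)) = r *\<^sub>R (munit j j * Q)" for Q
    using 1 by (metis mult.assoc mult_scaleR_left)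
  have "dag D * D = D"
    using r0 by (simp add: D_def left_diff_distrib right_diff_distrib mult.assoc EE mEm)
  moreover have "trR (E * munit j j * E) = r"
  proof -
    have "trR (munit j j) = 1" by (subst trR_eq[of "Suc j"]) auto
    moreover have "trR (E * munit j j * E) = trR ((E * munit j j) * (munit j j * E))"
      by (simp add: mult.assoc) (simp add: mult.assoc[symmetric])
    ultimately show ?thesis
      by (subst (asm) trR_commute[of "E * munit j j"]) (simp add: mult.assoc EE, simp add: mult.assoc[symmetric] 1)
  qed
  then have "trR D = 0" using r0 tr1 by (simp add: D_def)
  ultimately have "D = 0" using trR_dag_self_eq_0 by metis
  then have "E = (1 / r) *\<^sub>R (E * munit j j * E)" by (simp add: D_def)
  from arg_cong[OF this, of "scaleR r"] have "E * munit j j * E = r *\<^sub>R E" using r0 by simp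
  with r0 1 show thesis using that by blast
qed

lemma (in quadruple) ex_V:
  assumes "\<Psi> = (1 / sqrt (real n)) *\<^sub>R idm n"
  obtains V where "\<And>k l. dag (V k) * V l = munit k l" "\<And>k. E * V k = V k"
    "\<And>k l M. V k * M * dag (V l) = cscale (ent M k l) E"
proof -
  obtain j r where r: "0 < r" "munit j j * E * munit j j = r *\<^sub>R munit j j" "E * munit j j * E = r *\<^sub>R E"
    using rank_one[OF assms] by blast
  \<comment> \<open>\<open>V k\<close> sends basis vector \<open>k\<close> to the normalized column
    \<open>j\<close> of \<open>E\<close>, which spans its range.\<close>
  define V where "V k = (1 / sqrt r) *\<^sub>R (E * munit j k)" for k :: nat
  have sq: "1 / sqrt r * (1 / sqrt r) = 1 / r" using r(1) by simp
  have EE: "E * (E * Q) = E * Q" for Q by (simp add: mult.assoc[symmetric])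
  show thesis
  proof (rule that[of V])
    fix k l
    have "dag (V k) * V l = (1 / r) *\<^sub>R (munit k j * E * munit j l)"
      using r(1) by (simp add: V_def mult.assoc EE)
    also have "munit k j * E * munit j l = munit k j * (munit j j * E * munit j j) * munit j l"
      by (simp add: mult.assoc[symmetric]) (simp add: mult.assoc)
    also have "\<dots> = r *\<^sub>R munit k l" by (simp add: r(2))
    finally show "dag (V k) * V l = munit k l" using r(1) by simp
  next
    fix k show "E * V k = V k" by (simp add: V_def EE)
  next
    fix k l M
    have "V k * M * dag (V l) = (1 / r) *\<^sub>R (E * (munit j k * M * munit l j) * E)"
      using r(1) by (simp add: V_def mult.assoc)
    also have "\<dots> = cscale (ent M k l) ((1 / r) *\<^sub>R (E * munit j j * E))"
      by (simp only: munit_times_munit) (rule fmat_eqI, simp add: ent_simps)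
    finally show "V k * M * dag (V l) = cscale (ent M k l) E" using r(1) by (simp add: r(3))
  qed
qed

text \<open>Once both positive matrices are factored, the trace is the squared norm of
  \<open>dag K * \<Psi> * L\<close>.\<close>

lemma psdf_trace_zero:
  assumes "psdf A" "psdf D" "trR (dag \<Psi> * A * \<Psi> * D) = 0"
  shows "A * \<Psi> * D = 0"
proof -
  obtain K L where K: "A = K * dag K" and L: "D = L * dag L"
    using psdf_factor assms(1,2) by metis
  have "trR (dag (dag K * \<Psi> * L) * (dag K * \<Psi> * L)) = trR (dag L * (dag \<Psi> * A * \<Psi> * L))"
    by (simp add: K mult.assoc)
  also have "\<dots> = 0"
    using assms(3) by (subst trR_commute) (simp add: L mult.assoc)
  finally have "dag K * \<Psi> * L = 0" by (simp only: trR_dag_self_eq_0)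
  then have "K * (dag K * \<Psi> * L) * dag L = 0" by simp
  then show ?thesis by (simp add: K L mult.assoc)
qed

section \<open>What the correlation of the model forces\<close>

locale model_projections =
  fixes n :: nat and P :: "nat \<Rightarrow> fmat" and \<epsilon> :: real
  assumes n_pos: "n \<ge> 1" and eps: "\<epsilon> * \<epsilon> = 1"
    and dagP: "\<And>i. i < 4 \<Longrightarrow> dag (P i) = P i"
    and idemP: "\<And>i. i < 4 \<Longrightarrow> P i * P i = P i"
    and suppP: "\<And>i. i < 4 \<Longrightarrow> P i * idm n = P i"
    and sumP: "P 0 + P 1 + P 2 + P 3 = (2 - 1 / real n) *\<^sub>R idm n"
    and trP: "trR (P 0) - trR (P 1) = \<epsilon>"
begin

lemma trR_idm: "trR (idm d) = real d"
  by (subst trR_eq[of d]) auto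

lemma quad_P: "quadruple n P P ((1 / sqrt (real n)) *\<^sub>R idm n) \<epsilon>"
proof
  have i: "idm n * P i = P i" if "i < 4" for i
    using suppP[OF that] dagP[OF that] by (metis dag_idm dag_times)
  fix i :: nat assume "i < 4"
  then show "P i * ((1 / sqrt (real n)) *\<^sub>R idm n) = (1 / sqrt (real n)) *\<^sub>R idm n * P i"
    by (simp add: suppP i)
  from \<open>i < 4\<close> show "P i * (P i * ((1 / sqrt (real n)) *\<^sub>R idm n)) = P i * ((1 / sqrt (real n)) *\<^sub>R idm n)"
    by (simp add: suppP idemP)
next
  show "(P 0 + P 1 + P 2 + P 3) * ((1 / sqrt (real n)) *\<^sub>R idm n)
      = (2 - 1 / real n) *\<^sub>R ((1 / sqrt (real n)) *\<^sub>R idm n)"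
    unfolding sumP by (simp add: mult.commute)
  show "trR (dag ((1 / sqrt (real n)) *\<^sub>R idm n) * ((1 / sqrt (real n)) *\<^sub>R idm n)) = 1"
    using n_pos by (simp add: trR_idm)
  have "idm n * (P 0 - P 1) = P 0 - P 1"
    using suppP[of 0] suppP[of 1] dagP[of 0] dagP[of 1]
    by (metis (no_types, opaque_lifting) dag_idm dag_times right_diff_distrib zero_less_numeral one_less_numeral_iff semiring_norm(76))
  then show "trR (dag ((1 / sqrt (real n)) *\<^sub>R idm n) * (P 0 - P 1) * ((1 / sqrt (real n)) *\<^sub>R idm n))
      = \<epsilon> / real n"
    using n_pos trP suppP[of 0] suppP[of 1] by (simp add: left_diff_distrib diff_divide_distrib[symmetric])
qed (use n_pos eps dagP in auto)

text \<open>Equal inputs never give different outcomes, which forces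
  \<open>A i * \<Psi> = \<Psi> * C i\<close>. The sum condition follows since the norm of its defect
  can be computed from the correlation.\<close>

lemma quad_from_correlation:
  assumes psdA: "\<And>i. i < 4 \<Longrightarrow> psdf (A i)" "\<And>i. i < 4 \<Longrightarrow> psdf (idm d - A i)"
    and psdC: "\<And>i. i < 4 \<Longrightarrow> psdf (C i)" "\<And>i. i < 4 \<Longrightarrow> psdf (idm e - C i)"
    and supp: "idm d * \<Psi> = \<Psi>" "\<Psi> * idm e = \<Psi>"
    and one: "trR (dag \<Psi> * \<Psi>) = 1"
    and AC: "\<And>i j. i < 4 \<Longrightarrow> j < 4 \<Longrightarrow> trR (dag \<Psi> * A i * \<Psi> * C j) = trR (P i * P j) / real n"
    and A: "\<And>i. i < 4 \<Longrightarrow> trR (dag \<Psi> * A i * \<Psi>) = trR (P i) / real n"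
    and C: "\<And>j. j < 4 \<Longrightarrow> trR (dag \<Psi> * \<Psi> * C j) = trR (P j) / real n"
  shows "quadruple n A C \<Psi> \<epsilon>"
proof -
  have dagA: "dag (A i) = A i" and dagC: "dag (C i) = C i" if "i < 4" for i
    using psdA(1)[OF that] psdC(1)[OF that] by (auto simp: psdf_def)
  have both: "A i * \<Psi> = A i * \<Psi> * C i" "\<Psi> * C i = A i * \<Psi> * C i" if i: "i < 4" for i
  proof -
    \<comment> \<open>The probability of outcome 0 for Alice and 1 for Bob on input
      \<open>i\<close>; it is zero because \<open>P i\<close> is idempotent.\<close>
    have "trR (dag \<Psi> * A i * \<Psi> * (idm e - C i)) = 0"
      using A[OF i] AC[OF i i] by (simp add: right_diff_distrib mult.assoc supp idemP[OF i])
    from psdf_trace_zero[OF psdA(1)[OF i] psdC(2)[OF i] this]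
    show "A i * \<Psi> = A i * \<Psi> * C i"
      unfolding right_diff_distrib mult.assoc supp right_minus_eq .
    have "trR (dag \<Psi> * (idm d - A i) * \<Psi> * C i) = 0"
      using C[OF i] AC[OF i i]
      by (simp add: right_diff_distrib left_diff_distrib mult.assoc supp idemP[OF i])
    from psdf_trace_zero[OF psdA(2)[OF i] psdC(1)[OF i] this]
    show "\<Psi> * C i = A i * \<Psi> * C i"
      by (simp only: left_diff_distrib supp right_minus_eq)
  qed
  have inter: "A i * \<Psi> = \<Psi> * C i" if "i < 4" for i using both[OF that] by simp
  have idem: "A i * (A i * \<Psi>) = A i * \<Psi>" if "i < 4" for i
    using both[OF that] inter[OF that] by (metis mult.assoc)
  have AA: "trR (dag \<Psi> * A i * A j * \<Psi>) = trR (P i * P j) / real n" if "i < 4" "j < 4" for i j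
    using AC[OF that] inter[OF that(2)] by (simp add: mult.assoc)
  define c where "c = 2 - 1 / real n"
  define I4 :: "nat set" where "I4 = {..<4}"
  have I4: "(\<Sum>i\<in>I4. f i) = f 0 + f 1 + f 2 + f 3" for f :: "nat \<Rightarrow> 'a :: comm_monoid_add"
    by (simp add: I4_def eval_nat_numeral One_nat_def)
  define SA where "SA = (\<Sum>i\<in>I4. A i)"
  define SP where "SP = (\<Sum>i\<in>I4. P i)"
  have SP: "SP = c *\<^sub>R idm n" by (simp only: SP_def I4 sumP c_def)
  have dagSA: "dag SA = SA" unfolding SA_def dag_sum by (rule sum.cong) (auto simp: I4_def dagA)
  have "trR (dag \<Psi> * SA * SA * \<Psi>) = (\<Sum>i\<in>I4. \<Sum>j\<in>I4. trR (dag \<Psi> * A i * A j * \<Psi>))"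
    by (simp add: SA_def sum_distrib_left sum_distrib_right trR_sum mult.assoc)
      (rule sum.swap)
  also have "\<dots> = (\<Sum>i\<in>I4. \<Sum>j\<in>I4. trR (P i * P j) / real n)"
    by (intro sum.cong refl) (auto simp: I4_def AA)
  also have "\<dots> = trR (SP * SP) / real n"
    by (simp add: SP_def sum_distrib_left sum_distrib_right trR_sum sum_divide_distrib)
      (rule sum.swap)
  also have "\<dots> = c * c" using n_pos by (simp add: SP trR_idm)
  finally have sq: "trR (dag \<Psi> * SA * SA * \<Psi>) = c * c" .
  have "trR (dag \<Psi> * SA * \<Psi>) = (\<Sum>i\<in>I4. trR (dag \<Psi> * A i * \<Psi>))"
    by (simp add: SA_def sum_distrib_left sum_distrib_right trR_sum)
  also have "\<dots> = (\<Sum>i\<in>I4. trR (P i) / real n)" by (rule sum.cong) (auto simp: I4_def A)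
  also have "\<dots> = trR SP / real n" by (simp add: SP_def trR_sum sum_divide_distrib)
  also have "\<dots> = c" using n_pos by (simp add: SP trR_idm)
  finally have lin: "trR (dag \<Psi> * SA * \<Psi>) = c" .
  \<comment> \<open>The squared norm of the defect, equal to
    \<open>c * c - 2 * c * c + c * c\<close>.\<close>
  have "trR (dag (SA * \<Psi> - c *\<^sub>R \<Psi>) * (SA * \<Psi> - c *\<^sub>R \<Psi>))
      = trR (dag \<Psi> * SA * SA * \<Psi>) - 2 * c * trR (dag \<Psi> * SA * \<Psi>) + c * c * trR (dag \<Psi> * \<Psi>)"
    by (simp add: dagSA left_diff_distrib right_diff_distrib mult.assoc)
  also have "\<dots> = 0" by (simp add: sq lin one)
  finally have "SA * \<Psi> = c *\<^sub>R \<Psi>" by (simp only: trR_dag_self_eq_0) simp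
  moreover have "trR (dag \<Psi> * (A 0 - A 1) * \<Psi>) = \<epsilon> / real n"
    using A[of 0] A[of 1] trP
    by (simp add: left_diff_distrib right_diff_distrib diff_divide_distrib[symmetric])
  ultimately show ?thesis
    using n_pos eps dagA dagC inter idem one by unfold_locales (auto simp: SA_def I4 c_def)
qed

text \<open>\<open>U k\<close> and \<open>W l\<close> are the slices of the local isometries at the basis vectors
  \<open>k\<close>, \<open>l\<close> of the auxiliary spaces; Bob's operators are transposed, so that both sides act on
  the matrix \<open>\<Psi>\<close> of the state.\<close>
lemma dilation_slices:
  assumes quadruple: "quadruple n A C \<Psi> \<epsilon>" "quadruple n C A (dag \<Psi>) \<epsilon>"
    and supp: "idm d * \<Psi> = \<Psi>" "\<Psi> * idm e = \<Psi>"
  obtains U W :: "nat \<Rightarrow> fmat" and \<Phi> where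
    "(\<Sum>k<d. dag (U k) * U k) = idm d" "(\<Sum>k<e. dag (W k) * W k) = idm e"
    "\<And>k. idm n * U k = U k" "\<And>k. idm n * W k = W k"
    "\<And>k i. i < 4 \<Longrightarrow> U k * (A i * \<Psi>) = P i * (U k * \<Psi>)"
    "\<And>k i. i < 4 \<Longrightarrow> \<Psi> * C i * dag (W k) = \<Psi> * dag (W k) * P i"
    "\<And>k l. U k * \<Psi> * dag (W l) = cscale (ent \<Phi> k l) (idm n)"
    "idm d * \<Phi> = \<Phi>" "\<Phi> * idm e = \<Phi>"
    "trR (dag \<Phi> * \<Phi>) = 1 / real n"
proof -
  interpret P: quadruple n P P "(1 / sqrt (real n)) *\<^sub>R idm n" \<epsilon> by (rule quad_P)
  obtain V where V: "\<And>k l. dag (V k) * V l = munit k l" "\<And>k. P.E * V k = V k"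
    "\<And>k l M. V k * M * dag (V l) = cscale (ent M k l) P.E"
    using P.ex_V[OF refl] by blast
  have supp': "idm e * dag \<Psi> = dag \<Psi>" using supp(2) by (metis dag_idm dag_times)
  interpret L: dilation_pair n A C \<Psi> \<epsilon> P d V
    by (intro dilation_pair.intro dilation_pair_axioms.intro quadruple quad_P supp suppP V)
  have R: "dilation_pair n C A (dag \<Psi>) \<epsilon> P e V"
    by (intro dilation_pair.intro dilation_pair_axioms.intro quadruple quad_P supp' suppP V)
  then interpret R: dilation_pair n C A "dag \<Psi>" \<epsilon> P e V .
  have idm_V: "idm n * V k = V k" for k
    by (metis V(2) L.P_PI P.E_facts(5) mult.assoc)
  \<comment> \<open>Up to normalization, the auxiliary state is the part of \<open>\<Psi>\<close>
    over the kernel of \<open>X\<close>.\<close>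
  show thesis
  proof (rule that[of L.T R.T "L.L.E * \<Psi>"])
    show "(\<Sum>k<d. dag (L.T k) * L.T k) = idm d" by (rule L.T_isometry)
    show "(\<Sum>k<e. dag (R.T k) * R.T k) = idm e" by (rule R.T_isometry)
    show "idm n * L.T k = L.T k" for k
      using L.T0_PI(2)[of k] idm_V[of k] by (simp add: L.T_def distrib_left L.P_PI mult.assoc[symmetric])
    show "idm n * R.T k = R.T k" for k
      using R.T0_PI(2)[of k] idm_V[of k] by (simp add: R.T_def distrib_left R.P_PI mult.assoc[symmetric])
    show "L.T k * (A i * \<Psi>) = P i * (L.T k * \<Psi>)" if "i < 4" for i k
      by (rule L.T_A[OF that])
    show "\<Psi> * C i * dag (R.T k) = \<Psi> * dag (R.T k) * P i" if "i < 4" for i k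
      using arg_cong[OF R.T_A[OF that], of dag k] R.L.dagA[OF that] dagP[OF that]
      by (simp add: mult.assoc)
    show "L.T k * \<Psi> * dag (R.T l) = cscale (ent (L.L.E * \<Psi>) k l) (idm n)" for k l
      by (rule L.T_Psi_T[OF R])
    show "idm d * (L.L.E * \<Psi>) = L.L.E * \<Psi>"
      by (metis L.L.E_facts(5) L.idm_PI(1) mult.assoc)
    show "L.L.E * \<Psi> * idm e = L.L.E * \<Psi>" by (simp add: mult.assoc supp)
    have "dag (L.L.E * \<Psi>) * (L.L.E * \<Psi>) = dag \<Psi> * L.L.E * \<Psi>"
      by (simp add: mult.assoc) (simp add: mult.assoc[symmetric])
    then show "trR (dag (L.L.E * \<Psi>) * (L.L.E * \<Psi>)) = 1 / real n"
      using L.L.extremal(1) by (simp add: L.L.\<tau>_def)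
  qed
qed

end

subsection \<open>Strategies\<close>

definition emb :: "complex mat \<Rightarrow> fmat" where
  "emb M = fm (dim_row M) (dim_col M) (\<lambda>i j. M $$ (i, j))"

definition embT :: "complex mat \<Rightarrow> fmat" where
  "embT M = fm (dim_col M) (dim_row M) (\<lambda>i j. M $$ (j, i))"

definition mtx :: "nat \<Rightarrow> nat \<Rightarrow> complex vec \<Rightarrow> fmat" where
  "mtx p q v = fm p q (\<lambda>i j. v $ (i * q + j))"

lemma ent_emb [simp]:
  "ent (emb M) i j = (if i < dim_row M \<and> j < dim_col M then M $$ (i, j) else 0)"
  "ent (embT M) i j = (if i < dim_col M \<and> j < dim_row M then M $$ (j, i) else 0)"
  "ent (mtx p q v) i j = (if i < p \<and> j < q then v $ (i * q + j) else 0)"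
  by (simp_all add: emb_def embT_def mtx_def)

lemma pair_index:
  fixes i j p q :: nat
  assumes "i < p" "j < q"
  shows "i * q + j < p * q" "(i * q + j) div q = i" "(i * q + j) mod q = j"
proof -
  have "i * q + j < i * q + q" using assms by simp
  also have "\<dots> = Suc i * q" by simp
  also have "\<dots> \<le> p * q" by (rule mult_le_mono1) (use assms in simp)
  finally show "i * q + j < p * q" .
qed (use assms in auto)

lemma sum_pair_index: "(\<Sum>x<p * q. f x) = (\<Sum>i<p. \<Sum>j<q. f (i * q + j))" for p q :: nat
proof (induction p)
  case (Suc p)
  have "(\<Sum>x<q + p * q. f x) = (\<Sum>x<p * q. f x) + (\<Sum>x\<in>{p * q..<p * q + q}. f x)"
    by (subst sum.atLeastLessThan_concat[of 0 "p * q", unfolded atLeast0LessThan, symmetric])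
      (simp_all add: add.commute)
  also have "(\<Sum>x\<in>{p * q..<p * q + q}. f x) = (\<Sum>j<q. f (p * q + j))"
    using sum.shift_bounds_nat_ivl[of f 0 "p * q" q] by (simp add: atLeast0LessThan add.commute)
  finally show ?case using Suc by simp
qed simp

text \<open>For a bipartite vector read as a matrix, a tensor product acts by multiplication on both
  sides; on the right this takes the plain transpose rather than the adjoint, hence
  \<open>embT\<close>.\<close>

lemma mtx_kron:
  assumes "M \<in> carrier_mat p q" "N \<in> carrier_mat r s" "dim_vec v = q * s"
  shows "mtx p r (kron M N *\<^sub>v v) = emb M * mtx q s v * embT N"
proof (rule fmat_eqI)
  fix i j
  have R: "ent (emb M * mtx q s v * embT N) i j
      = (\<Sum>l<s. (\<Sum>k<q. ent (emb M) i k * ent (mtx q s v) k l) * ent (embT N) l j)"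
    using assms by (subst ent_times[of s], simp add: ent_times[of q] ent_times'[of q])
      (simp add: ent_times'[of q])
  show "ent (mtx p r (kron M N *\<^sub>v v)) i j = ent (emb M * mtx q s v * embT N) i j"
  proof (cases "i < p \<and> j < r")
    case True
    have "(kron M N *\<^sub>v v) $ (i * r + j) = (\<Sum>x<q * s. kron M N $$ (i * r + j, x) * v $ x)"
      using True assms pair_index(1)[of i p j r]
      by (simp add: kron_def scalar_prod_def atLeast0LessThan)
    also have "\<dots> = (\<Sum>k<q. \<Sum>l<s. M $$ (i, k) * N $$ (j, l) * v $ (k * s + l))"
      unfolding sum_pair_index using True assms
      by (intro sum.cong refl) (simp add: kron_def pair_index)
    also have "\<dots> = ent (emb M * mtx q s v * embT N) i j"
      unfolding R using True assms
      by (subst sum.swap) (auto simp: sum_distrib_left sum_distrib_right mult_ac intro!: sum.cong)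
    finally show ?thesis using True by simp
  next
    case False
    then show ?thesis unfolding R using assms by auto
  qed
qed

lemma cinner_mtx:
  assumes "dim_vec v = p * r"
  shows "Re (cinner v w) = trR (dag (mtx p r v) * mtx p r w)"
proof -
  have "trR (dag (mtx p r v) * mtx p r w)
      = (\<Sum>j<r. Re (\<Sum>i<p. cnj (v $ (i * r + j)) * w $ (i * r + j)))"
    by (subst trR_eq[of r]) (simp_all add: ent_times'[of p])
  also have "\<dots> = Re (cinner v w)"
    unfolding cinner_def assms sum_pair_index by (subst sum.swap) simp
  finally show ?thesis ..
qed

lemma Re_correlation:
  assumes "M \<in> carrier_mat p p" "N \<in> carrier_mat r r" "dim_vec v = p * r"
  shows "Re (cinner v (kron M N *\<^sub>v v)) = trR (dag (mtx p r v) * emb M * mtx p r v * embT N)"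
  using mtx_kron[OF assms] cinner_mtx[OF assms(3)] by (simp add: mult.assoc)

text \<open>Polarization: the quadratic form is real at combinations of two basis vectors, and the
  coefficients (1, 0), (0, 1), (1, 1) and (1, \<open>\<i>\<close>) give the claim.\<close>

lemma psd_entries_hermitian:
  assumes "psd d M" "i < d" "j < d"
  shows "M $$ (j, i) = cnj (M $$ (i, j))"
proof -
  define q where "q v = (\<Sum>k<d. \<Sum>l<d. cnj (v k) * (M $$ (k, l) * v l))" for v :: "nat \<Rightarrow> complex"
  have M: "M \<in> carrier_mat d d" using assms(1) by (simp add: psd_def)
  have q: "Im (q v) = 0" for v
  proof -
    have "cinner (vec d v) (M *\<^sub>v vec d v) = q v"
      using M by (auto simp: cinner_def q_def scalar_prod_def atLeast0LessThan sum_distrib_left intro!: sum.cong)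
    then show ?thesis using assms(1) unfolding psd_def by (metis vec_carrier)
  qed
  have sum_pt: "(\<Sum>k<d. cnj (if k = i then a else 0) * f k) = cnj a * f i"
    "(\<Sum>k<d. f k * (if k = i then a else 0)) = f i * a"  if "i < d" for i a and f :: "nat \<Rightarrow> complex"
    using that by (auto simp: if_distrib[of cnj] if_distrib[of "\<lambda>x. x * _"] if_distrib[of "\<lambda>x. _ * x"] if_distribR cong: if_cong)
  have eq: "q (\<lambda>k. (if k = i then a else 0) + (if k = j then b else 0))
      = cnj a * M $$ (i, i) * a + cnj a * M $$ (i, j) * b + cnj b * M $$ (j, i) * a + cnj b * M $$ (j, j) * b" for a b
  proof -
    define v where "v k = (if k = i then a else 0) + (if k = j then b else 0)" for k
    have "(\<Sum>l<d. M $$ (k, l) * v l) = M $$ (k, i) * a + M $$ (k, j) * b" for k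
      using assms(2,3) by (simp add: v_def distrib_left sum.distrib sum_pt)
    then have "q v = (\<Sum>k<d. cnj (v k) * (M $$ (k, i) * a + M $$ (k, j) * b))"
      by (simp add: q_def sum_distrib_left[symmetric])
    also have "\<dots> = cnj a * (M $$ (i, i) * a + M $$ (i, j) * b) + cnj b * (M $$ (j, i) * a + M $$ (j, j) * b)"
      by (simp only: v_def complex_cnj_add distrib_right[of "cnj _"] sum.distrib sum_pt(1)[OF assms(2)] sum_pt(1)[OF assms(3)])
    finally show ?thesis by (simp add: v_def[abs_def] algebra_simps)
  qed
  have I: "Im (cnj a * M $$ (i, i) * a + cnj a * M $$ (i, j) * b + cnj b * M $$ (j, i) * a + cnj b * M $$ (j, j) * b) = 0" for a b
    using q[of "\<lambda>k. (if k = i then a else 0) + (if k = j then b else 0)"] unfolding eq .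
  show ?thesis
    using I[of 1 0] I[of 0 1] I[of 1 1] I[of 1 \<i>] by (simp add: complex_eq_iff)
qed

text \<open>The trace form at \<open>V\<close> is the sum of the quadratic forms at the columns of
  \<open>V\<close>; for the transpose, the columns are conjugated.\<close>

lemma psdf_of_psd:
  assumes "psd d M"
  shows "psdf (emb M)" "psdf (embT M)"
proof -
  have M: "M \<in> carrier_mat d d" using assms by (simp add: psd_def)
  have pos: "0 \<le> Re (\<Sum>k<d. \<Sum>l<d. cnj (v k) * (M $$ (k, l) * v l))" for v
  proof -
    have "cinner (vec d v) (M *\<^sub>v vec d v) = (\<Sum>k<d. \<Sum>l<d. cnj (v k) * (M $$ (k, l) * v l))"
      using M by (auto simp: cinner_def scalar_prod_def atLeast0LessThan sum_distrib_left intro!: sum.cong)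
    then show ?thesis using assms unfolding psd_def by (metis vec_carrier)
  qed
  have form: "trR (dag V * F * V) = (\<Sum>j<e. Re (\<Sum>k<d. \<Sum>l<d. cnj (ent V k j) * (ent F k l * ent V l j)))"
    if "\<And>i j. e \<le> j \<Longrightarrow> ent V i j = 0" "\<And>k l. d \<le> k \<Longrightarrow> ent F k l = 0" "\<And>k l. d \<le> l \<Longrightarrow> ent F k l = 0" for V F e
  proof -
    have "ent (dag V * F * V) i j = (\<Sum>k<d. \<Sum>l<d. cnj (ent V k i) * (ent F k l * ent V l j))" for i j
      unfolding mult.assoc
      by (subst ent_times'[of d]) (simp_all add: ent_times[of d F] that sum_distrib_left)
    then show ?thesis by (subst trR_eq[of e]) (simp_all add: that)
  qed
  have "cnj (M $$ (j, i)) = M $$ (i, j)" if "i < d" "j < d" for i j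
    by (simp add: psd_entries_hermitian[OF assms that])
  then have "dag (emb M) = emb M" "dag (embT M) = embT M"
    using M by (auto intro!: fmat_eqI)
  moreover have "0 \<le> trR (dag V * emb M * V)" "0 \<le> trR (dag V * embT M * V)" for V
  proof -
    obtain e where e: "\<forall>i j. ent V i j \<noteq> 0 \<longrightarrow> i < e \<and> j < e" using ent_bounded by blast
    have z: "\<And>i j. e \<le> j \<Longrightarrow> ent V i j = 0" using e not_le by blast
    show "0 \<le> trR (dag V * emb M * V)"
    proof (subst form[OF z])
      show "0 \<le> (\<Sum>j<e. Re (\<Sum>k<d. \<Sum>l<d. cnj (ent V k j) * (ent (emb M) k l * ent V l j)))"
      proof (rule sum_nonneg)
        fix j
        show "0 \<le> Re (\<Sum>k<d. \<Sum>l<d. cnj (ent V k j) * (ent (emb M) k l * ent V l j))"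
          using pos[of "\<lambda>k. ent V k j"] M by simp
      qed
    qed (use M in auto)
    show "0 \<le> trR (dag V * embT M * V)"
    proof (subst form[OF z])
      show "0 \<le> (\<Sum>j<e. Re (\<Sum>k<d. \<Sum>l<d. cnj (ent V k j) * (ent (embT M) k l * ent V l j)))"
      proof (rule sum_nonneg)
        fix j
        have "(\<Sum>k<d. \<Sum>l<d. cnj (ent V k j) * (ent (embT M) k l * ent V l j))
          = (\<Sum>k<d. \<Sum>l<d. cnj (cnj (ent V k j)) * (M $$ (k, l) * cnj (ent V l j)))"
          using M by (subst sum.swap) (simp add: mult_ac)
        then show "0 \<le> Re (\<Sum>k<d. \<Sum>l<d. cnj (ent V k j) * (ent (embT M) k l * ent V l j))"
          using pos[of "\<lambda>k. cnj (ent V k j)"] by metis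
      qed
    qed (use M in auto)
  qed
  ultimately show "psdf (emb M)" "psdf (embT M)" by (auto simp: psdf_def)
qed

section \<open>Two-outcome measurements\<close>

lemma povm_two:
  assumes "povm d 2 M"
  shows "psd d (M 0)" "psd d (M 1)" "emb (M 1) = idm d - emb (M 0)" "embT (M 1) = idm d - embT (M 0)"
    "M 0 \<in> carrier_mat d d" "M 1 \<in> carrier_mat d d"
proof -
  show p: "psd d (M 0)" "psd d (M 1)" using assms by (auto simp: povm_def)
  then show c: "M 0 \<in> carrier_mat d d" "M 1 \<in> carrier_mat d d" by (auto simp: psd_def)
  have "M 0 + (M 1 + 0\<^sub>m d d) = 1\<^sub>m d" using assms by (simp add: povm_def upt_rec eval_nat_numeral One_nat_def)
  then have "(M 0 + (M 1 + 0\<^sub>m d d)) $$ (i, j) = 1\<^sub>m d $$ (i, j)" for i j by simp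
  then have e: "M 0 $$ (i, j) + M 1 $$ (i, j) = (if i = j then 1 else 0)" if "i < d" "j < d" for i j
    using that c by (metis (no_types, lifting) add.right_neutral index_add_mat(1) index_one_mat(1) index_zero_mat(1) right_add_zero_mat carrier_matD)
  have "M 1 $$ (i, j) = (if i = j then 1 else 0) - M 0 $$ (i, j)" if "i < d" "j < d" for i j
    using e[OF that] by (metis add_diff_cancel_left')
  then show "emb (M 1) = idm d - emb (M 0)" "embT (M 1) = idm d - embT (M 0)"
    using c by (auto intro!: fmat_eqI simp: ent_simps)
qed

definition outcome :: "nat \<Rightarrow> fmat \<Rightarrow> nat \<Rightarrow> fmat" where
  "outcome d M a = (if a = 0 then M else idm d - M)"

lemma povm_outcome:
  assumes "povm d 2 M" "a < 2"
  shows "M a \<in> carrier_mat d d" "emb (M a) = outcome d (emb (M 0)) a" "embT (M a) = outcome d (embT (M 0)) a"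
proof -
  have "a = 0 \<or> a = 1" using assms(2) by auto
  then show "M a \<in> carrier_mat d d" "emb (M a) = outcome d (emb (M 0)) a" "embT (M a) = outcome d (embT (M 0)) a"
    using povm_two[OF assms(1)] by (auto simp: outcome_def)
qed

text \<open>Symmetry of \<open>Q\<close> makes the plain and the transposed embedding coincide, so
  both parties share the same model operators.\<close>

lemma proj_meas_outcome:
  assumes "Q \<in> carrier_mat n n" "transpose_mat Q = Q"
  shows "proj_meas n Q a \<in> carrier_mat n n" "emb (proj_meas n Q a) = outcome n (emb (cmat Q)) a"
    "embT (proj_meas n Q a) = outcome n (emb (cmat Q)) a"
proof -
  have t: "Q $$ (j, i) = Q $$ (i, j)" if "i < n" "j < n" for i j
    using assms that by (metis carrier_matD index_transpose_mat(1))
  show "proj_meas n Q a \<in> carrier_mat n n" "emb (proj_meas n Q a) = outcome n (emb (cmat Q)) a"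
    using assms(1) by (auto simp: proj_meas_def cmat_def outcome_def ent_simps intro!: fmat_eqI)
  show "embT (proj_meas n Q a) = outcome n (emb (cmat Q)) a"
    using assms(1) by (auto simp: proj_meas_def cmat_def outcome_def ent_simps t intro!: fmat_eqI)
qed

lemma mtx_phi: "mtx n n (phi n) = (1 / sqrt (real n)) *\<^sub>R idm n"
  by (rule fmat_eqI) (auto simp: phi_def ent_simps pair_index)

text \<open>The sign is the trace difference of the first two projections, read off from their ranks
  by \<open>trace_idempotent\<close>.\<close>

lemma model_projections_frak_P:
  assumes "n \<ge> 1" "frak_P n P"
  shows "model_projections n (\<lambda>i. emb (cmat (P i))) (- ((-1) ^ n))"
proof
  have P: "P i \<in> carrier_mat n n" "transpose_mat (P i) = P i" "P i * P i = P i" if "i < 4" for i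
    using assms(2) that by (auto simp: frak_P_def)
  have t: "P i $$ (k, j) = P i $$ (j, k)" if "i < 4" "j < n" "k < n" for i j k
    using P(1,2)[OF that(1)] that by (metis carrier_matD index_transpose_mat(1))
  show "1 \<le> n" by fact
  show "- ((-1) ^ n) * - ((-1) ^ n) = (1 :: real)" by (simp flip: power_mult_distrib)
  show "dag (emb (cmat (P i))) = emb (cmat (P i))" if "i < 4" for i
    using P(1)[OF that] t[OF that] by (auto simp: cmat_def intro!: fmat_eqI)
  show "emb (cmat (P i)) * emb (cmat (P i)) = emb (cmat (P i))" if "i < 4" for i
  proof (rule fmat_eqI)
    fix j k
    have "complex_of_real (\<Sum>l<n. P i $$ (j, l) * P i $$ (l, k)) = complex_of_real (P i $$ (j, k))"
      if "j < n" "k < n"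
    proof -
      have "(P i * P i) $$ (j, k) = (\<Sum>l<n. P i $$ (j, l) * P i $$ (l, k))"
        using P(1)[OF \<open>i < 4\<close>] that by (simp add: scalar_prod_def atLeast0LessThan)
      then show ?thesis using P(3)[OF \<open>i < 4\<close>] by simp
    qed
    then show "ent (emb (cmat (P i)) * emb (cmat (P i))) j k = ent (emb (cmat (P i))) j k"
      using P(1)[OF that] by (subst ent_times[of n]) (auto simp: cmat_def)
  qed
  show "emb (cmat (P i)) * idm n = emb (cmat (P i))" if "i < 4" for i
    using P(1)[OF that] by (intro fmat_eqI) (auto simp: cmat_def)
  have s: "P 0 + P 1 + P 2 + P 3 = (2 - 1 / real n) \<cdot>\<^sub>m 1\<^sub>m n"
    using assms(2) by (simp add: frak_P_def)
  have "P 0 $$ (j, k) + P 1 $$ (j, k) + P 2 $$ (j, k) + P 3 $$ (j, k) = (2 - 1 / real n) * (if j = k then 1 else 0)"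
    if "j < n" "k < n" for j k
    using arg_cong[OF s, of "\<lambda>M. M $$ (j, k)"] that P(1)[of 0] P(1)[of 1] P(1)[of 2] P(1)[of 3] by simp
  then have "complex_of_real (P 0 $$ (j, k) + P 1 $$ (j, k) + P 2 $$ (j, k) + P 3 $$ (j, k))
      = complex_of_real ((2 - 1 / real n) * (if j = k then 1 else 0))"
    if "j < n" "k < n" for j k using that by presburger
  then show "emb (cmat (P 0)) + emb (cmat (P 1)) + emb (cmat (P 2)) + emb (cmat (P 3)) = (2 - 1 / real n) *\<^sub>R idm n"
    using P(1)[of 0] P(1)[of 1] P(1)[of 2] P(1)[of 3]
    by (intro fmat_eqI) (auto simp: cmat_def ent_simps)
  have tr: "trR (emb (cmat (P i))) = real (vec_space.rank n (P i))" if "i < 4" for i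
  proof -
    have "trR (emb (cmat (P i))) = (\<Sum>j<n. P i $$ (j, j))"
      using P(1)[OF that] by (subst trR_eq[of n]) (auto simp: cmat_def)
    then show ?thesis using vec_space.trace_idempotent[OF P(1,3)[OF that]] by simp
  qed
  have "int (vec_space.rank n (P 0)) = int (n div 2) - (-1) ^ n" "vec_space.rank n (P 1) = n div 2"
    using assms(2) by (auto simp: frak_P_def)
  then have "int (vec_space.rank n (P 0)) - int (vec_space.rank n (P 1)) = - ((-1) ^ n)" by simp
  then have "real_of_int (int (vec_space.rank n (P 0)) - int (vec_space.rank n (P 1))) = real_of_int (- ((-1) ^ n))"
    by (rule arg_cong)
  then show "trR (emb (cmat (P 0))) - trR (emb (cmat (P 1))) = - ((-1) ^ n)"
    by (simp add: tr)
qed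

section \<open>Local isometries from slices\<close>

lemma isometry_of_slices:
  assumes "(\<Sum>k<d. dag (T k) * T k) = idm d" "\<And>k. idm n * T k = T k"
  shows "isometry (n * d) d (mat (n * d) d (\<lambda>(r, j). ent (T (r mod d)) (r div d) j))"
    and "isometry (n * d) d (mat (n * d) d (\<lambda>(r, j). cnj (ent (T (r mod d)) (r div d) j)))"
proof -
  have supp: "ent (T k) x j = 0" if "n \<le> x" for k x j
    using assms(2)[of k] that by (metis ent_idm_times not_le)
  have "(\<Sum>r<n * d. cnj (ent (T (r mod d)) (r div d) i) * ent (T (r mod d)) (r div d) j) = ent (idm d) i j" for i j
  proof -
    \<comment> \<open>Row \<open>x * d + k\<close> of the isometry is row \<open>x\<close> of slice
      \<open>k\<close>, with the auxiliary index running fastest.\<close>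
    have "(\<Sum>r<n * d. cnj (ent (T (r mod d)) (r div d) i) * ent (T (r mod d)) (r div d) j)
      = (\<Sum>x<n. \<Sum>k<d. cnj (ent (T k) x i) * ent (T k) x j)"
      unfolding sum_pair_index by (intro sum.cong refl) (simp add: pair_index)
    also have "\<dots> = ent (\<Sum>k<d. dag (T k) * T k) i j"
      by (subst sum.swap) (simp add: ent_sum ent_times'[of n] supp)
    finally show ?thesis using assms(1) by simp
  qed note * = this
  show "isometry (n * d) d (mat (n * d) d (\<lambda>(r, j). ent (T (r mod d)) (r div d) j))"
    unfolding isometry_def
    by (intro conjI eq_matI) (auto simp: adj_def scalar_prod_def atLeast0LessThan *)
  have **: "(\<Sum>r<n * d. ent (T (r mod d)) (r div d) i * cnj (ent (T (r mod d)) (r div d) j)) = ent (idm d) i j" for i j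
    using arg_cong[OF *[of i j], of cnj] by simp
  show "isometry (n * d) d (mat (n * d) d (\<lambda>(r, j). cnj (ent (T (r mod d)) (r div d) j)))"
    unfolding isometry_def
    by (intro conjI eq_matI) (auto simp: adj_def scalar_prod_def atLeast0LessThan **)
qed

text \<open>Bob's operator enters through its plain transpose, so the conjugate in \<open>UB\<close>
  is what produces \<open>dag (W l)\<close>.\<close>

lemma regroup_slices:
  fixes n d e :: nat and U W :: "nat \<Rightarrow> fmat"
  defines "UA \<equiv> mat (n * d) d (\<lambda>(r, j). ent (U (r mod d)) (r div d) j)"
    and "UB \<equiv> mat (n * e) e (\<lambda>(r, j). cnj (ent (W (r mod e)) (r div e) j))"
  assumes "dim_vec v = d * e" "x < n" "y < n" "k < d" "l < e"
  shows "(kron UA UB *\<^sub>v v) $ ((x * d + k) * (n * e) + (y * e + l))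
    = ent (U k * mtx d e v * dag (W l)) x y"
proof -
  note i = pair_index[OF \<open>x < n\<close> \<open>k < d\<close>] pair_index[OF \<open>y < n\<close> \<open>l < e\<close>]
  have UA: "UA \<in> carrier_mat (n * d) d" and UB: "UB \<in> carrier_mat (n * e) e"
    by (simp_all add: UA_def UB_def)
  have "(kron UA UB *\<^sub>v v) $ ((x * d + k) * (n * e) + (y * e + l))
    = ent (emb UA * mtx d e v * embT UB) (x * d + k) (y * e + l)"
    unfolding mtx_kron[OF UA UB assms(3), symmetric] using i by simp
  also have "\<dots> = (\<Sum>b<e. (\<Sum>a<d. ent (emb UA) (x * d + k) a * ent (mtx d e v) a b) * ent (embT UB) b (y * e + l))"
    using UB by (subst ent_times'[of e], simp) (simp add: ent_times'[of d])
  also have "\<dots> = (\<Sum>b<e. (\<Sum>a<d. ent (U k) x a * ent (mtx d e v) a b) * ent (dag (W l)) b y)"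
    using i by (intro sum.cong refl) (simp add: UA_def UB_def)
  also have "\<dots> = ent (U k * mtx d e v * dag (W l)) x y"
    by (subst ent_times[of e], subst ent_times'[of d]) (simp_all add: ent_times'[of d])
  finally show ?thesis .
qed

theorem theorem5p2:
  fixes n :: nat and P :: "nat \<Rightarrow> real mat"
  assumes "n \<ge> 1" and "frak_P n P"
  shows "self_tested 4 4 (\<lambda>_. 2) (\<lambda>_. 2) (S_strat n P)"
  unfolding self_tested_def
proof (intro allI impI, elim conjE)
  fix S
  assume S: "is_strategy 4 4 (\<lambda>_. 2) (\<lambda>_. 2) S"
    and corr: "\<forall>i<4. \<forall>j<4. \<forall>a<2. \<forall>b<2. correlation S a b i j = correlation (S_strat n P) a b i j"
  define \<epsilon> :: real where "\<epsilon> = - ((-1) ^ n)"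
  define p where "p = (\<lambda>i. emb (cmat (P i)))"
  interpret model_projections n p \<epsilon>
    unfolding p_def \<epsilon>_def by (rule model_projections_frak_P[OF assms])
  define dA dB \<psi> where "dA = dimA S" and "dB = dimB S" and "\<psi> = state S"
  define A C \<Psi> where "A i = emb (measA S i 0)" and "C i = embT (measB S i 0)" and "\<Psi> = mtx dA dB \<psi>" for i
  have \<psi>: "dim_vec \<psi> = dA * dB" "cinner \<psi> \<psi> = 1"
    and povmA: "\<And>i. i < 4 \<Longrightarrow> povm dA 2 (measA S i)" and povmB: "\<And>i. i < 4 \<Longrightarrow> povm dB 2 (measB S i)"
    and pos: "dA > 0" "dB > 0"
    using S by (auto simp: is_strategy_def unit_vec_c_def dA_def dB_def \<psi>_def)
  note selA = povm_outcome[OF povmA] and selB = povm_outcome[OF povmB]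
  have P: "P i \<in> carrier_mat n n" "transpose_mat (P i) = P i" if "i < 4" for i
    using assms(2) that by (auto simp: frak_P_def)
  have selP: "proj_meas n (P i) a \<in> carrier_mat n n" "emb (proj_meas n (P i) a) = outcome n (p i) a"
    "embT (proj_meas n (P i) a) = outcome n (p i) a" if "i < 4" for i a
    using proj_meas_outcome[OF P[OF that]] by (simp_all add: p_def)
  have phi: "dim_vec (phi n) = n * n" by (simp add: phi_def)
  have supp: "idm dA * \<Psi> = \<Psi>" "\<Psi> * idm dB = \<Psi>"
    by (rule fmat_eqI, simp add: \<Psi>_def)+
  have ip: "idm n * p i = p i" if "i < 4" for i
    using suppP[OF that] dagP[OF that] by (metis dag_idm dag_times)
  have outcome_p: "outcome n (p i) a * idm n = outcome n (p i) a" "idm n * outcome n (p i) a = outcome n (p i) a" if "i < 4" for i a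
    using suppP[OF that] ip[OF that] by (simp_all add: outcome_def left_diff_distrib right_diff_distrib)
  have eq: "trR (dag \<Psi> * outcome dA (A i) a * \<Psi> * outcome dB (C j) b) = trR (outcome n (p i) a * outcome n (p j) b) / real n"
    if "i < 4" "j < 4" "a < 2" "b < 2" for i j a b
  proof -
    have "trR (dag \<Psi> * outcome dA (A i) a * \<Psi> * outcome dB (C j) b) = Re (correlation S a b i j)"
      using Re_correlation[OF selA(1)[OF that(1,3)] selB(1)[OF that(2,4)] \<psi>(1)]
        selA(2)[OF that(1,3)] selB(3)[OF that(2,4)]
      by (simp add: correlation_def \<psi>_def A_def C_def \<Psi>_def)
    also have "\<dots> = Re (correlation (S_strat n P) a b i j)" using corr that by simp
    also have "\<dots> = trR (dag (mtx n n (phi n)) * outcome n (p i) a * mtx n n (phi n) * outcome n (p j) b)"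
      using Re_correlation[OF selP(1)[OF that(1)] selP(1)[OF that(2)] phi, of a b]
        selP(2)[OF that(1)] selP(3)[OF that(2)]
      by (simp add: correlation_def S_strat_def)
    also have "\<dots> = trR (outcome n (p i) a * outcome n (p j) b) / real n"
      using n_pos by (simp add: mtx_phi outcome_p[OF that(1)])
    finally show ?thesis .
  qed
  have AC: "trR (dag \<Psi> * A i * \<Psi> * C j) = trR (p i * p j) / real n" if "i < 4" "j < 4" for i j
    using eq[OF that, of 0 0] by (simp add: outcome_def)
  \<comment> \<open>Summing over Bob's two outcomes gives Alice's marginals.\<close>
  have margA: "trR (dag \<Psi> * A i * \<Psi>) = trR (p i) / real n" if "i < 4" for i
    using eq[OF that that, of 0 0] eq[OF that that, of 0 1] suppP[OF that]
    by (simp add: outcome_def right_diff_distrib mult.assoc supp diff_divide_distrib)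
  have margB: "trR (dag \<Psi> * \<Psi> * C i) = trR (p i) / real n" if "i < 4" for i
    using eq[OF that that, of 0 0] eq[OF that that, of 1 0] ip[OF that]
    by (simp add: outcome_def right_diff_distrib left_diff_distrib supp mult.assoc diff_divide_distrib)
  have one: "trR (dag \<Psi> * \<Psi>) = 1"
    using cinner_mtx[OF \<psi>(1), of \<psi>] by (simp add: \<Psi>_def \<psi>(2))
  have psd: "psdf (A i)" "psdf (idm dA - A i)" "psdf (C i)" "psdf (idm dB - C i)" if "i < 4" for i
    using povm_two[OF povmA[OF that]] povm_two[OF povmB[OF that]] psdf_of_psd
    by (metis A_def C_def)+
  have quad1: "quadruple n A C \<Psi> \<epsilon>"
    by (rule quad_from_correlation[OF psd supp one AC margA margB])
  \<comment> \<open>Exchanging the parties replaces the matrix of the state by its adjoint; the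
    traces agree by cyclicity.\<close>
  have quad2: "quadruple n C A (dag \<Psi>) \<epsilon>"
  proof (rule quad_from_correlation[OF psd(3,4,1,2)])
    show "idm dB * dag \<Psi> = dag \<Psi>" "dag \<Psi> * idm dA = dag \<Psi>"
      using supp by (metis dag_idm dag_times)+
    show "trR (dag (dag \<Psi>) * dag \<Psi>) = 1" using one by (simp add: trR_commute)
    show "trR (dag (dag \<Psi>) * C i * dag \<Psi> * A j) = trR (p i * p j) / real n" if "i < 4" "j < 4" for i j
      using AC[OF that(2,1)] trR_commute[of "p i" "p j"] trR_commute[of "\<Psi> * C i" "dag \<Psi> * A j"] by (simp add: mult.assoc)
    show "trR (dag (dag \<Psi>) * C i * dag \<Psi>) = trR (p i) / real n" if "i < 4" for i
      using margB[OF that] trR_commute[of "\<Psi> * C i" "dag \<Psi>"] by (simp add: mult.assoc)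
    show "trR (dag (dag \<Psi>) * dag \<Psi> * A i) = trR (p i) / real n" if "i < 4" for i
      using margA[OF that] trR_commute[of "\<Psi>" "dag \<Psi> * A i"] by (simp add: mult.assoc)
  qed
  obtain U W \<Phi> where
    UW: "(\<Sum>k<dA. dag (U k) * U k) = idm dA" "(\<Sum>k<dB. dag (W k) * W k) = idm dB"
      "\<And>k. idm n * U k = U k" "\<And>k. idm n * W k = W k"
    and interU: "\<And>k i. i < 4 \<Longrightarrow> U k * (A i * \<Psi>) = p i * (U k * \<Psi>)"
    and interW: "\<And>k i. i < 4 \<Longrightarrow> \<Psi> * C i * dag (W k) = \<Psi> * dag (W k) * p i"
    and state: "\<And>k l. U k * \<Psi> * dag (W l) = cscale (ent \<Phi> k l) (idm n)"
    and \<Phi>: "idm dA * \<Phi> = \<Phi>" "\<Phi> * idm dB = \<Phi>" "trR (dag \<Phi> * \<Phi>) = 1 / real n"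
    using dilation_slices[OF quad1 quad2 supp] by blast
  have outcome_inter: "U k * (outcome dA (A i) a * \<Psi> * outcome dB (C j) b) * dag (W l)
      = cscale (ent \<Phi> k l) (outcome n (p i) a * outcome n (p j) b)" if "i < 4" "j < 4" for i j a b k l
  proof -
    have "U k * (outcome dA (A i) a * \<Psi>) = outcome n (p i) a * (U k * \<Psi>)"
    proof -
      have "idm n * (U k * \<Psi>) = U k * \<Psi>" by (simp only: mult.assoc[symmetric] UW(3))
      then show ?thesis using interU[OF that(1)]
        by (simp add: outcome_def left_diff_distrib right_diff_distrib supp mult.assoc)
    qed
    moreover have "\<Psi> * outcome dB (C j) b * dag (W l) = \<Psi> * dag (W l) * outcome n (p j) b"
    proof -
      have "dag (W l) * idm n = dag (W l)" using UW(4)[of l] by (metis dag_idm dag_times)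
      moreover have "\<Psi> * (idm dB * dag (W l)) = \<Psi> * dag (W l)"
        by (simp only: mult.assoc[symmetric] supp)
      ultimately show ?thesis using interW[OF that(2)]
        by (simp add: outcome_def left_diff_distrib right_diff_distrib mult.assoc)
    qed
    ultimately have "U k * (outcome dA (A i) a * \<Psi> * outcome dB (C j) b) * dag (W l)
        = outcome n (p i) a * (U k * \<Psi> * dag (W l)) * outcome n (p j) b"
      by (metis mult.assoc)
    then show ?thesis by (simp add: state outcome_p[OF that(1)])
  qed
  \<comment> \<open>\<open>\<Phi>\<close> has squared norm 1/n; the factor
    \<open>sqrt (real n)\<close> normalizes it and is compensated by the amplitude of
    \<open>phi n\<close>.\<close>
  define aux where "aux = vec (dA * dB) (\<lambda>r. of_real (sqrt (real n)) * ent \<Phi> (r div dB) (r mod dB))"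
  have aux: "unit_vec_c (dA * dB) aux"
  proof -
    have "cinner v v = of_real (\<Sum>r<dim_vec v. (cmod (v $ r))\<^sup>2)" for v
      by (simp add: cinner_def complex_norm_square mult.commute[of "cnj _"] del: of_real_power)
    moreover have "mtx dA dB aux = sqrt (real n) *\<^sub>R \<Phi>"
    proof (rule fmat_eqI)
      fix i j
      have "ent \<Phi> i j = 0" if "\<not> (i < dA \<and> j < dB)"
        using \<Phi>(1,2) that by (metis ent_idm_times ent_times_idm)
      then show "ent (mtx dA dB aux) i j = ent (sqrt (real n) *\<^sub>R \<Phi>) i j"
        by (auto simp: aux_def pair_index ent_simps)
    qed
    then have "Re (cinner aux aux) = 1"
      using cinner_mtx[of aux dA dB aux] n_pos \<Phi>(3) by (simp add: aux_def)
    ultimately have "cinner aux aux = 1" by (metis Re_complex_of_real of_real_1)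
    then show ?thesis by (simp add: unit_vec_c_def aux_def)
  qed
  define UA where "UA = mat (n * dA) dA (\<lambda>(r, j). ent (U (r mod dA)) (r div dA) j)"
  define UB where "UB = mat (n * dB) dB (\<lambda>(r, j). cnj (ent (W (r mod dB)) (r div dB) j))"
  have main: "regroup n dA n dB (kron UA UB *\<^sub>v (kron (measA S i a) (measB S j b) *\<^sub>v \<psi>))
      = kron_vec (kron (proj_meas n (P i) a) (proj_meas n (P j) b) *\<^sub>v phi n) aux"
    if "i < 4" "j < 4" "a < 2" "b < 2" for i j a b
  proof (rule eq_vecI)
    define v where "v = kron (measA S i a) (measB S j b) *\<^sub>v \<psi>"
    define u where "u = kron (proj_meas n (P i) a) (proj_meas n (P j) b) *\<^sub>v phi n"
    have v: "dim_vec v = dA * dB" using selA(1)[OF that(1,3)] selB(1)[OF that(2,4)] by (simp add: v_def kron_def)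
    have u: "dim_vec u = n * n" using selP(1)[OF that(1), of a] selP(1)[OF that(2), of b] by (simp add: u_def kron_def)
    have mv: "mtx dA dB v = outcome dA (A i) a * \<Psi> * outcome dB (C j) b"
      unfolding v_def mtx_kron[OF selA(1)[OF that(1,3)] selB(1)[OF that(2,4)] \<psi>(1)]
        selA(2)[OF that(1,3)] selB(3)[OF that(2,4)] by (simp add: A_def C_def \<Psi>_def)
    have mtx_u: "mtx n n u = (1 / sqrt (real n)) *\<^sub>R (outcome n (p i) a * outcome n (p j) b)"
      using mtx_kron[OF selP(1)[OF that(1)] selP(1)[OF that(2)] phi, of a b]
        selP(2)[OF that(1)] selP(3)[OF that(2)]
      by (simp add: u_def mtx_phi outcome_p[OF that(1)])
    show "dim_vec (regroup n dA n dB (kron UA UB *\<^sub>v v)) = dim_vec (kron_vec u aux)"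
      by (simp add: regroup_def kron_vec_def u aux_def)
    fix idx assume "idx < dim_vec (kron_vec u aux)"
    then have idx: "idx < n * n * (dA * dB)" by (simp add: kron_vec_def u aux_def)
    \<comment> \<open>The tensor indices of \<open>idx\<close> in the regrouped order:
      \<open>ab\<close> splits into \<open>x\<close>, \<open>y\<close> for the model spaces,
      \<open>kk\<close> into \<open>k\<close>, \<open>l\<close> for the auxiliary ones.\<close>
    define ab kk where "ab = idx div (dA * dB)" and "kk = idx mod (dA * dB)"
    define x y k l where "x = ab div n" and "y = ab mod n" and "k = kk div dB" and "l = kk mod dB"
    have ab: "ab < n * n" using idx by (simp add: ab_def less_mult_imp_div_less)
    have kk: "kk < dA * dB" using pos by (simp add: kk_def)
    have xy: "x < n" "y < n" "k < dA" "l < dB" "ab = x * n + y"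
      using ab kk n_pos pos by (simp_all add: x_def y_def k_def l_def less_mult_imp_div_less)
    have "regroup n dA n dB (kron UA UB *\<^sub>v v) $ idx
        = (kron UA UB *\<^sub>v v) $ ((x * dA + k) * (n * dB) + (y * dB + l))"
      using idx by (simp add: regroup_def Let_def x_def y_def k_def l_def ab_def kk_def)
    also have "\<dots> = ent (cscale (ent \<Phi> k l) (outcome n (p i) a * outcome n (p j) b)) x y"
      unfolding UA_def UB_def regroup_slices[OF v xy(1-4)] mv outcome_inter[OF that(1,2)] ..
    also have "\<dots> = ent (mtx n n u) x y * (of_real (sqrt (real n)) * ent \<Phi> k l)"
      using n_pos by (simp add: mtx_u ent_simps)
    also have "\<dots> = u $ ab * aux $ kk"
      using xy kk by (simp add: aux_def k_def l_def)
    also have "\<dots> = kron_vec u aux $ idx"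
      using idx by (simp add: kron_vec_def u aux_def ab_def kk_def)
    finally show "regroup n dA n dB (kron UA UB *\<^sub>v v) $ idx = kron_vec u aux $ idx" .
  qed
  have "isometry (n * dA) dA UA" "isometry (n * dB) dB UB"
    unfolding UA_def UB_def using isometry_of_slices UW by blast+
  \<comment> \<open>The auxiliary spaces have the dimensions of the given strategy's own local
    spaces.\<close>
  then show "local_dilation 4 4 (\<lambda>_. 2) (\<lambda>_. 2) (S_strat n P) S"
    unfolding local_dilation_def
    using main aux pos
    by (intro exI[of _ dA] exI[of _ dB] exI[of _ aux] exI[of _ UA] exI[of _ UB])
      (simp add: S_strat_def dA_def dB_def \<psi>_def)
qed

end
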